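(* For $\mu\in\mathbb{R}$, let $F(\mu)=\sqrt{\lambda_1(\mu)}$, where $\lambda_1(\mu)$ is the lowest eigenvalue of $H_\mu=-d_x^2+(\mu+x^2)^2$ on $L^2(\mathbb{R},dx)$. Then there exists $a$ with $-1<a<0$ such that $F'(\mathbb{R})=[a,1)$.
   Context: $H_\mu$ is essentially self-adjoint; $d_x^2$ denotes the second derivative in $x$. The function $F$ is analytic on $\mathbb{R}$, and $F'(\mathbb{R})$ denotes the range of its derivative. *)

theory Defs
  imports "HOL-Analysis.Analysis"
begin

text \<open>
  Elements of the complex Hilbert space of square-integrable functions on the line are
  represented by Borel functions. Almost everywhere equality is not quotiented out:
  \<open>L2_dist\<close> is only a pseudo-distance, and a vector is nonzero iff it is not
  almost everywhere zero.
\<close>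

definition L2_space :: "(real \<Rightarrow> complex) set" where
  "L2_space = {u \<in> borel_measurable lborel. integrable lborel (\<lambda>x. (cmod (u x))\<^sup>2)}"

definition L2_dist :: "(real \<Rightarrow> complex) \<Rightarrow> (real \<Rightarrow> complex) \<Rightarrow> real" where
  "L2_dist u v = sqrt (LINT x|lborel. (cmod (u x - v x))\<^sup>2)"

definition vderiv :: "(real \<Rightarrow> complex) \<Rightarrow> real \<Rightarrow> complex" where
  "vderiv u = (\<lambda>x. vector_derivative u (at x))"

definition test_functions :: "(real \<Rightarrow> complex) set" where
  "test_functions =
     {\<phi>. (\<forall>k x. (vderiv ^^ k) \<phi> differentiable (at x)) \<and> compact (closure {x. \<phi> x \<noteq> 0})}"

definition H_expr :: "real \<Rightarrow> (real \<Rightarrow> complex) \<Rightarrow> real \<Rightarrow> complex" where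
  "H_expr \<mu> u = (\<lambda>x. - vderiv (vderiv u) x + complex_of_real ((\<mu> + x\<^sup>2)\<^sup>2) * u x)"

text \<open>
  The operator is essentially self-adjoint on test functions, so the self-adjoint operator
  meant by \<open>H\<close> is the closure of the differential expression on test functions, i.e. the
  operator whose graph is the closure of the initial graph. \<open>H_graph \<mu> u w\<close> says that
  \<open>u\<close> is in the domain of the closure and is mapped to \<open>w\<close>.
\<close>

definition H_graph :: "real \<Rightarrow> (real \<Rightarrow> complex) \<Rightarrow> (real \<Rightarrow> complex) \<Rightarrow> bool" where
  "H_graph \<mu> u w \<longleftrightarrow> u \<in> L2_space \<and> w \<in> L2_space \<and>
     (\<exists>\<phi>. (\<forall>n::nat. \<phi> n \<in> test_functions) \<and>
          (\<lambda>n. L2_dist (\<phi> n) u) \<longlonglongrightarrow> 0 \<and>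
          (\<lambda>n. L2_dist (H_expr \<mu> (\<phi> n)) w) \<longlonglongrightarrow> 0)"

definition H_eigenvalue :: "real \<Rightarrow> complex \<Rightarrow> bool" where
  "H_eigenvalue \<mu> z \<longleftrightarrow>
     (\<exists>u. H_graph \<mu> u (\<lambda>x. z * u x) \<and> \<not> (AE x in lborel. u x = 0))"

definition lambda1 :: "real \<Rightarrow> real" where
  "lambda1 \<mu> = (LEAST l. H_eigenvalue \<mu> (complex_of_real l))"

definition F :: "real \<Rightarrow> real" where
  "F \<mu> = sqrt (lambda1 \<mu>)"

end

theory Submission
  imports Defs
begin

text \<open>
The ground state is produced by shooting and everything else is read off from it. Let \<open>u\<close> be the
even solution of \<open>u'' = (V - l) u\<close>, \<open>u 0 = 1\<close>, with \<open>V x = (\<mu> + x\<^sup>2)\<^sup>2\<close>. On the half line exactly one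
of three things happens: \<open>u\<close> becomes negative (\<open>l\<close> is too large), \<open>u\<close> stays positive and eventually
increases (\<open>l\<close> is too small), or \<open>u\<close> stays positive and decays exponentially. The first two
alternatives are open in \<open>(\<mu>, l)\<close>, and the first persists when \<open>l\<close> grows (Sturm comparison). Hence
the infimum \<open>ground \<mu>\<close> of the \<open>l\<close> of the first kind is of the third kind, and it depends
continuously on \<open>\<mu>\<close>.

This number is the lowest eigenvalue (\<open>lambda1_eq_ground\<close>). The decaying solution, cut off by
\<open>bump (x / n)\<close>, shows that it is an eigenvalue of the closure. No eigenvalue is smaller, because
positivity of \<open>u\<close> factorizes the energy: with \<open>w = u' / u\<close>, the energy of a test function \<open>\<phi>\<close> minus
\<open>l\<close> times its squared norm is the integral of \<open>\<bar>\<phi>' - w \<phi>\<bar>\<^sup>2\<close>.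

Two ground states \<open>u\<close>, \<open>v\<close> for the parameters \<open>\<mu>\<close>, \<open>\<nu>\<close> are linked by the Wronskian, whose derivative is
\<open>((\<mu> - \<nu>) (\<mu> + \<nu> + 2 x\<^sup>2) - (ground \<mu> - ground \<nu>)) u v\<close>. Integration gives the exact formula
\<open>ground \<mu> - ground \<nu> = (\<mu> - \<nu>) * weighted_mean \<mu> \<nu>\<close>, where the mean is that of \<open>\<mu> + \<nu> + 2 x\<^sup>2\<close> with
weight \<open>u v\<close>. Since ground states converge pointwise under a common exponential bound, the mean
is continuous on the diagonal, and the energy is continuously differentiable with the
Feynman-Hellmann derivative \<open>2 * moment \<mu> / mass \<mu>\<close>, twice the normalized expectation of
\<open>\<mu> + x\<^sup>2\<close>.

For \<open>F = sqrt (ground \<mu>)\<close> this yields the range of \<open>F'\<close>: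

  \<^item> \<open>\<bar>F'\<bar> < 1\<close>, because the expectation of \<open>\<mu> + x\<^sup>2\<close> is at most the square root of that of \<open>V\<close>, and the
    total energy contains kinetic energy in addition (\<open>moment_lt\<close>);

  \<^item> the supremum is \<open>1\<close>, because \<open>F \<mu> > \<mu>\<close> for \<open>\<mu> \<ge> 0\<close>, so \<open>F\<close> cannot have slope at most \<open>c < 1\<close>
    everywhere;

  \<^item> \<open>F' \<ge> 0\<close> for \<open>\<mu> \<ge> 0\<close>, and for \<open>\<mu> < 0\<close> the virial identity gives \<open>F' \<ge> - F / \<bar>\<mu>\<bar>\<close>, which tends to \<open>0\<close> as
    \<open>\<mu>\<close> tends to \<open>-\<infinity>\<close> because \<open>ground \<mu>\<close> is \<open>O(\<bar>\<mu>\<bar>)\<close>;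

  \<^item> \<open>F'\<close> takes a negative value, because the energy tends to infinity as \<open>\<mu>\<close> tends to \<open>-\<infinity>\<close>
    (\<open>ground_lower_well\<close>).

So the continuous function \<open>F'\<close> attains a negative minimum on a compact interval, that minimum is
above \<open>-1\<close>, and connectedness fills the interval up to the unattained supremum \<open>1\<close>.
\<close>

section \<open>The even solution of the eigenvalue equation\<close>

definition pot :: "real \<Rightarrow> real \<Rightarrow> real" where
  "pot m x = (m + x\<^sup>2)\<^sup>2"

text \<open>
The solution is even, so it is expanded in powers of \<open>t = x\<^sup>2\<close>. If \<open>f\<close> is its expansion, then
\<open>u x = f (x\<^sup>2)\<close> solves \<open>u'' = (V - l) u\<close> iff \<open>4 t f'' + 2 f' = ((m + t)\<^sup>2 - l) f\<close>. The recursion below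
compares coefficients in this equation. In all comments \<open>V\<close>, \<open>u\<close> and \<open>u'\<close> stand for \<open>pot m\<close>, \<open>sol m l\<close> and
\<open>dsol m l\<close>.
\<close>

fun sol_coeff :: "real \<Rightarrow> real \<Rightarrow> nat \<Rightarrow> real" where
  "sol_coeff m l 0 = 1"
| "sol_coeff m l (Suc k) =
     ((m\<^sup>2 - l) * sol_coeff m l k + (if 1 \<le> k then 2 * m * sol_coeff m l (k - 1) else 0)
       + (if 2 \<le> k then sol_coeff m l (k - 2) else 0)) / (real (2 * k + 1) * real (2 * k + 2))"

declare sol_coeff.simps(2) [simp del]

definition sol_fps :: "real \<Rightarrow> real \<Rightarrow> real fps" where
  "sol_fps m l = Abs_fps (sol_coeff m l)"

definition sol :: "real \<Rightarrow> real \<Rightarrow> real \<Rightarrow> real" where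
  "sol m l x = eval_fps (sol_fps m l) (x\<^sup>2)"

definition dsol :: "real \<Rightarrow> real \<Rightarrow> real \<Rightarrow> real" where
  "dsol m l x = 2 * x * eval_fps (fps_deriv (sol_fps m l)) (x\<^sup>2)"

text \<open>
The denominator of the recursion grows quadratically in \<open>k\<close>, so from some index on it exceeds the
sum of the three coefficients, weighted by the powers of \<open>R\<close> that the index shifts cost. From there
on no coefficient times \<open>R ^ n\<close> can exceed the maximum of the preceding ones.
\<close>

lemma sol_coeff_bounded:
  assumes R: "R \<ge> 1"
  shows "\<exists>C. \<forall>n. \<bar>sol_coeff m l n\<bar> * R ^ n \<le> C"
proof -
  (* The shift by j in the recursion costs a factor R ^ (j + 1), at most R ^ 3. *)
  define c where "c = (\<bar>m\<^sup>2 - l\<bar> + 2 * \<bar>m\<bar> + 1) * R ^ 3"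
  obtain N :: nat where N: "c \<le> real N" using real_arch_simple by blast
  define C where "C = (\<Sum>i\<le>N. \<bar>sol_coeff m l i\<bar> * R ^ i)"
  have C0: "C \<ge> 0" unfolding C_def using R by (intro sum_nonneg) auto
  have "\<bar>sol_coeff m l n\<bar> * R ^ n \<le> C" for n
  proof (induction n rule: less_induct)
    case (less n)
    show ?case
    proof (cases "n \<le> N")
      case True
      then show ?thesis unfolding C_def
        using R by (intro member_le_sum[where f="\<lambda>i. \<bar>sol_coeff m l i\<bar> * R ^ i"]) auto
    next
      case False
      then obtain k where k: "n = Suc k" "k \<ge> N" by (cases n) auto
      let ?b = "\<lambda>i. \<bar>sol_coeff m l i\<bar>"
      let ?D = "real (2 * k + 1) * real (2 * k + 2)"
      have D: "c \<le> ?D"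
      proof -
        have "c \<le> real k" using N k by linarith
        also have "\<dots> \<le> 1 * real (2 * k + 2)" by simp
        also have "\<dots> \<le> ?D" by (intro mult_right_mono) auto
        finally show ?thesis .
      qed
      have D0: "?D > 0" by auto
      have Rpow: "R \<le> R ^ 3" "R ^ 2 \<le> R ^ 3" using R by (auto intro: power_increasing self_le_power)
      have t0: "?b k * R ^ Suc k \<le> R ^ 3 * C"
      proof -
        have "?b k * R ^ Suc k = R * (?b k * R ^ k)" by simp
        also have "\<dots> \<le> R ^ 3 * C" using less[of k] k R Rpow C0
          by (intro mult_mono) auto
        finally show ?thesis .
      qed
      have t1: "(if 1 \<le> k then ?b (k - 1) else 0) * R ^ Suc k \<le> R ^ 3 * C"
      proof (cases "1 \<le> k")
        case True
        then obtain j where j: "k = Suc j" by (cases k) auto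
        have "?b j * R ^ Suc k = R ^ 2 * (?b j * R ^ j)" by (simp add: j power2_eq_square)
        also have "\<dots> \<le> R ^ 3 * C" using less[of j] j k R Rpow C0
          by (intro mult_mono) auto
        finally show ?thesis by (simp add: j)
      qed (use R C0 in auto)
      have t2: "(if 2 \<le> k then ?b (k - 2) else 0) * R ^ Suc k \<le> R ^ 3 * C"
      proof (cases "2 \<le> k")
        case True
        then obtain j where j: "k = j + 2" by (metis add.commute le_Suc_ex)
        have "?b j * R ^ Suc k = R ^ 3 * (?b j * R ^ j)" by (simp add: j power3_eq_cube)
        also have "\<dots> \<le> R ^ 3 * C" using less[of j] j k R Rpow C0
          by (intro mult_mono) auto
        finally show ?thesis by (simp add: j)
      qed (use R C0 in auto)
      have "?b n \<le> (\<bar>m\<^sup>2 - l\<bar> * ?b k + 2 * \<bar>m\<bar> * (if 1 \<le> k then ?b (k - 1) else 0)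
                + (if 2 \<le> k then ?b (k - 2) else 0)) / ?D"
      proof -
        have "?b n = \<bar>(m\<^sup>2 - l) * sol_coeff m l k + (if 1 \<le> k then 2 * m * sol_coeff m l (k - 1) else 0)
            + (if 2 \<le> k then sol_coeff m l (k - 2) else 0)\<bar> / ?D"
          unfolding k sol_coeff.simps(2) abs_divide using D0 by simp
        also have "\<dots> \<le> (\<bar>(m\<^sup>2 - l) * sol_coeff m l k\<bar> + \<bar>if 1 \<le> k then 2 * m * sol_coeff m l (k - 1) else 0\<bar>
            + \<bar>if 2 \<le> k then sol_coeff m l (k - 2) else 0\<bar>) / ?D"
          using D0 by (intro divide_right_mono) linarith+
        finally show ?thesis by (simp add: abs_mult if_distrib cong: if_cong)
      qed
      then have "?b n * R ^ n \<le> (\<bar>m\<^sup>2 - l\<bar> * ?b k + 2 * \<bar>m\<bar> * (if 1 \<le> k then ?b (k - 1) else 0)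
                + (if 2 \<le> k then ?b (k - 2) else 0)) / ?D * R ^ n"
        using R by (intro mult_right_mono) auto
      also have "\<dots> = (\<bar>m\<^sup>2 - l\<bar> * (?b k * R ^ Suc k) + 2 * \<bar>m\<bar> * ((if 1 \<le> k then ?b (k - 1) else 0) * R ^ Suc k)
                + (if 2 \<le> k then ?b (k - 2) else 0) * R ^ Suc k) / ?D"
        unfolding k(1) times_divide_eq_left by (simp only: distrib_right mult.assoc)
      also have "\<dots> \<le> (\<bar>m\<^sup>2 - l\<bar> * (R ^ 3 * C) + 2 * \<bar>m\<bar> * (R ^ 3 * C) + R ^ 3 * C) / ?D"
        using D0 t0 t1 t2 by (intro divide_right_mono add_mono mult_left_mono) auto
      also have "\<dots> = c * C / ?D" unfolding c_def by (simp add: algebra_simps)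
      also have "\<dots> \<le> ?D * C / ?D" using D C0 D0 by (intro divide_right_mono mult_right_mono) auto
      also have "\<dots> = C" using D0 by simp
      finally show ?thesis .
    qed
  qed
  then show ?thesis by blast
qed

lemma fps_conv_radius_sol [simp]: "fps_conv_radius (sol_fps m l) = \<infinity>"
proof -
  have "summable (\<lambda>n. sol_coeff m l n * z ^ n)" for z
  proof -
    define R where "R = 2 * (\<bar>z\<bar> + 1)"
    have R: "R \<ge> 1" "\<bar>z\<bar> / R \<le> 1/2" "R > 0" unfolding R_def by (auto simp: field_simps)
    obtain C where C: "\<And>n. \<bar>sol_coeff m l n\<bar> * R ^ n \<le> C" using sol_coeff_bounded[OF R(1)] by blast
    have C0: "C \<ge> 0" using C[of 0] by simp
    show ?thesis
    proof (rule summable_comparison_test')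
      show "summable (\<lambda>n. C * (1/2) ^ n)" by (intro summable_mult summable_geometric) auto
      fix n :: nat assume "0 \<le> n"
      have "norm (sol_coeff m l n * z ^ n) = (\<bar>sol_coeff m l n\<bar> * R ^ n) * (\<bar>z\<bar> / R) ^ n"
        using R by (simp add: abs_mult power_abs power_divide)
      also have "\<dots> \<le> C * (1/2) ^ n" using R C C0 by (intro mult_mono power_mono) auto
      finally show "norm (sol_coeff m l n * z ^ n) \<le> C * (1/2) ^ n" .
    qed
  qed
  then show ?thesis
    unfolding fps_conv_radius_def sol_fps_def fps_nth_Abs_fps by (intro conv_radius_inftyI'')
qed

lemma fps_conv_radius_infty_deriv:
  fixes f :: "real fps"
  assumes "fps_conv_radius f = \<infinity>"
  shows "fps_conv_radius (fps_deriv f) = \<infinity>"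
  using fps_conv_radius_deriv[of f] assms by simp

lemma fps_conv_radius_infty_mult:
  fixes f g :: "real fps"
  assumes "fps_conv_radius f = \<infinity>" "fps_conv_radius g = \<infinity>"
  shows "fps_conv_radius (f * g) = \<infinity>"
  using fps_conv_radius_mult[of f g] assms by simp

lemma fps_conv_radius_infty_add:
  fixes f g :: "real fps"
  assumes "fps_conv_radius f = \<infinity>" "fps_conv_radius g = \<infinity>"
  shows "fps_conv_radius (f + g) = \<infinity>"
  using fps_conv_radius_add[of f g] assms by simp

lemma sol_fps_ode:
  "fps_const 4 * (fps_X * fps_deriv (fps_deriv (sol_fps m l))) + fps_const 2 * fps_deriv (sol_fps m l)
    = fps_X ^ 2 * sol_fps m l + fps_const (2 * m) * (fps_X * sol_fps m l) + fps_const (m\<^sup>2 - l) * sol_fps m l"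
proof (rule fps_ext)
  fix n
  have "real (2 * n + 1) * real (2 * n + 2) * sol_coeff m l (Suc n) =
    (m\<^sup>2 - l) * sol_coeff m l n + (if 1 \<le> n then 2 * m * sol_coeff m l (n - 1) else 0)
       + (if 2 \<le> n then sol_coeff m l (n - 2) else 0)"
    by (simp add: sol_coeff.simps(2) del: of_nat_add of_nat_mult of_nat_Suc)
  then show "fps_nth (fps_const 4 * (fps_X * fps_deriv (fps_deriv (sol_fps m l))) + fps_const 2 * fps_deriv (sol_fps m l)) n
    = fps_nth (fps_X ^ 2 * sol_fps m l + fps_const (2 * m) * (fps_X * sol_fps m l) + fps_const (m\<^sup>2 - l) * sol_fps m l) n"
    unfolding sol_fps_def
    by (cases n) (auto simp: fps_X_power_mult_nth ring_distribs mult.assoc numeral_eq_Suc not_less_eq_eq split: if_splits)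
qed

lemma sol_fps_ode_eval:
  "4 * t * eval_fps (fps_deriv (fps_deriv (sol_fps m l))) t + 2 * eval_fps (fps_deriv (sol_fps m l)) t
    = ((m + t)\<^sup>2 - l) * eval_fps (sol_fps m l) t"
proof -
  note conv = fps_conv_radius_infty_deriv fps_conv_radius_infty_mult fps_conv_radius_infty_add
  show ?thesis
    using arg_cong[OF sol_fps_ode[of m l], of "\<lambda>f. eval_fps f t"]
    by (simp add: eval_fps_add eval_fps_mult conv power2_eq_square algebra_simps)
qed

lemma sol_0 [simp]: "sol m l 0 = 1"
  by (simp add: sol_def eval_fps_at_0 sol_fps_def)

lemma dsol_0 [simp]: "dsol m l 0 = 0"
  by (simp add: dsol_def)

lemma sol_minus [simp]: "sol m l (- x) = sol m l x"
  by (simp add: sol_def)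

lemma dsol_minus [simp]: "dsol m l (- x) = - dsol m l x"
  by (simp add: dsol_def)

lemma sol_has_deriv: "(sol m l has_real_derivative dsol m l x) (at x within A)"
proof -
  have "((\<lambda>x. eval_fps (sol_fps m l) (x\<^sup>2)) has_real_derivative
      eval_fps (fps_deriv (sol_fps m l)) (x\<^sup>2) * (2 * x)) (at x within A)"
    by (rule DERIV_chain2[where f="eval_fps (sol_fps m l)"], rule has_field_derivative_eval_fps)
      (auto intro!: derivative_eq_intros)
  then show ?thesis unfolding sol_def[abs_def] dsol_def by (simp add: mult_ac)
qed

lemma dsol_has_deriv: "(dsol m l has_real_derivative (pot m x - l) * sol m l x) (at x within A)"
proof -
  let ?f = "sol_fps m l"
  have 1: "((\<lambda>x. eval_fps (fps_deriv ?f) (x\<^sup>2)) has_real_derivative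
      eval_fps (fps_deriv (fps_deriv ?f)) (x\<^sup>2) * (2 * x)) (at x within A)"
    by (rule DERIV_chain2[where f="eval_fps (fps_deriv ?f)"], rule has_field_derivative_eval_fps)
      (auto intro!: derivative_eq_intros simp: fps_conv_radius_infty_deriv)
  have "((\<lambda>x. 2 * x * eval_fps (fps_deriv ?f) (x\<^sup>2)) has_real_derivative
     4 * x\<^sup>2 * eval_fps (fps_deriv (fps_deriv ?f)) (x\<^sup>2) + 2 * eval_fps (fps_deriv ?f) (x\<^sup>2)) (at x within A)"
    by (rule derivative_eq_intros 1 refl)+ (simp add: power2_eq_square algebra_simps)
  then show ?thesis unfolding sol_fps_ode_eval dsol_def[abs_def] pot_def sol_def .
qed

declare DERIV_chain2[OF sol_has_deriv, derivative_intros]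
declare DERIV_chain2[OF dsol_has_deriv, derivative_intros]

lemma continuous_on_sol [continuous_intros]:
  "continuous_on A f \<Longrightarrow> continuous_on A (\<lambda>x. sol m l (f x))"
  by (rule continuous_on_compose2[of UNIV "sol m l"])
    (auto intro!: DERIV_continuous_on sol_has_deriv)

lemma continuous_on_dsol [continuous_intros]:
  "continuous_on A f \<Longrightarrow> continuous_on A (\<lambda>x. dsol m l (f x))"
  by (rule continuous_on_compose2[of UNIV "dsol m l"])
    (auto intro!: DERIV_continuous_on dsol_has_deriv)

lemma continuous_on_pot [continuous_intros]:
  "continuous_on A f \<Longrightarrow> continuous_on A (\<lambda>x. pot m (f x))"
  unfolding pot_def by (intro continuous_intros)

section \<open>Continuous dependence on the parameters\<close>

text \<open>
The function \<open>e t * exp (- C t) - k t\<close> is nonincreasing.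
\<close>

lemma gronwall:
  fixes e e' :: "real \<Rightarrow> real"
  assumes der: "\<And>t. 0 \<le> t \<Longrightarrow> t \<le> x \<Longrightarrow> (e has_real_derivative e' t) (at t)"
    and le: "\<And>t. 0 \<le> t \<Longrightarrow> t \<le> x \<Longrightarrow> e' t \<le> C * e t + k"
    and "0 \<le> x" "0 \<le> C" "0 \<le> k"
  shows "e x \<le> (e 0 + k * x) * exp (C * x)"
proof -
  let ?g = "\<lambda>t. e t * exp (- (C * t)) - k * t"
  have "?g x \<le> ?g 0"
  proof (rule DERIV_nonpos_imp_nonincreasing[OF \<open>0 \<le> x\<close>])
    fix t assume t: "0 \<le> t" "t \<le> x"
    have d: "(?g has_real_derivative exp (- (C * t)) * (e' t - C * e t) - k) (at t)"
      by (rule derivative_eq_intros der t refl)+ (simp add: algebra_simps)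
    have "exp (- (C * t)) * (e' t - C * e t) \<le> exp (- (C * t)) * k"
      using le[OF t] by (intro mult_left_mono) auto
    also have "\<dots> \<le> 1 * k" using assms t by (intro mult_right_mono) auto
    finally show "\<exists>y. (?g has_real_derivative y) (at t) \<and> y \<le> 0" using d by force
  qed
  then have "e x * exp (- (C * x)) \<le> e 0 + k * x" by simp
  then have "e x * exp (- (C * x)) * exp (C * x) \<le> (e 0 + k * x) * exp (C * x)"
    by (intro mult_right_mono) auto
  then show ?thesis by (simp add: mult.assoc exp_minus)
qed

lemma pot_bound:
  assumes "\<bar>m\<bar> \<le> M" "\<bar>x\<bar> \<le> X"
  shows "pot m x \<le> (M + X\<^sup>2)\<^sup>2"
proof -
  have "x\<^sup>2 \<le> X\<^sup>2" using assms by (meson abs_le_square_iff abs_ge_self order.trans)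
  then have "\<bar>m + x\<^sup>2\<bar> \<le> M + X\<^sup>2" using assms zero_le_power2[of x] by linarith
  then show ?thesis unfolding pot_def by (simp add: abs_le_square_iff[symmetric])
qed

lemma pot_nonneg [simp]: "pot m x \<ge> 0" by (simp add: pot_def)

text \<open>
The coefficient \<open>1 + V - l\<close> is what governs the growth of \<open>u\<^sup>2 + u'\<^sup>2\<close>.
\<close>

lemma ode_coeff_bound:
  assumes "\<bar>m\<bar> \<le> M" "\<bar>l\<bar> \<le> M" "\<bar>x\<bar> \<le> X"
  shows "\<bar>1 + pot m x - l\<bar> \<le> 1 + (M + X\<^sup>2)\<^sup>2 + M"
  using pot_bound[OF assms(1,3)] assms(2) pot_nonneg[of m x] unfolding abs_le_iff by linarith

lemma two_mult_le: "2 * (a * b) \<le> a\<^sup>2 + (b::real)\<^sup>2"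
  using sum_squares_bound[of a b] by simp

lemma cross_term_le:
  assumes "\<bar>c\<bar> \<le> C"
  shows "c * (2 * (a * b)) \<le> C * (a\<^sup>2 + (b::real)\<^sup>2)"
proof -
  have "c * (2 * (a * b)) \<le> \<bar>c\<bar> * \<bar>2 * (a * b)\<bar>" by (metis abs_ge_self abs_mult)
  also have "\<dots> \<le> C * (a\<^sup>2 + b\<^sup>2)"
    using two_mult_le[of a b] two_mult_le[of a "-b"] assms by (intro mult_mono) auto
  finally show ?thesis .
qed

lemma sol_energy_has_deriv:
  "((\<lambda>x. (sol m l x)\<^sup>2 + (dsol m l x)\<^sup>2) has_real_derivative
     (1 + pot m x - l) * (2 * (sol m l x * dsol m l x))) (at x)"
  by (rule derivative_eq_intros refl)+ (simp add: algebra_simps)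

lemma sol_energy_bound:
  assumes "0 \<le> x" "x \<le> X" "\<bar>m\<bar> \<le> M" "\<bar>l\<bar> \<le> M"
  shows "(sol m l x)\<^sup>2 + (dsol m l x)\<^sup>2 \<le> exp ((1 + (M + X\<^sup>2)\<^sup>2 + M) * X)"
proof -
  define C where "C = 1 + (M + X\<^sup>2)\<^sup>2 + M"
  have C: "C \<ge> 0" unfolding C_def using assms by auto
  have "(\<lambda>x. (sol m l x)\<^sup>2 + (dsol m l x)\<^sup>2) x
    \<le> ((\<lambda>x. (sol m l x)\<^sup>2 + (dsol m l x)\<^sup>2) 0 + 0 * x) * exp (C * x)"
  proof (rule gronwall[OF sol_energy_has_deriv])
    fix t assume t: "0 \<le> t" "t \<le> x"
    have "\<bar>1 + pot m t - l\<bar> \<le> C"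
      using ode_coeff_bound[of m M l t X] assms t unfolding C_def by simp
    then show "(1 + pot m t - l) * (2 * (sol m l t * dsol m l t)) \<le> C * ((sol m l t)\<^sup>2 + (dsol m l t)\<^sup>2) + 0"
      using cross_term_le by simp
  qed (use assms C in auto)
  also have "\<dots> \<le> exp (C * X)" using C assms by (auto intro: mult_left_mono)
  finally show ?thesis unfolding C_def .
qed

text \<open>
The Gronwall argument also bounds \<open>u\<^sup>2 + u'\<^sup>2\<close> from below by an exponential, starting from its value
\<open>1\<close> at the origin. Consequently zeros of \<open>u\<close> are simple.
\<close>

lemma sol_dsol_not_both_zero:
  assumes "0 \<le> x" shows "(sol m l x)\<^sup>2 + (dsol m l x)\<^sup>2 > 0"
proof -
  define M where "M = max \<bar>m\<bar> \<bar>l\<bar>"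
  define C where "C = 1 + (M + x\<^sup>2)\<^sup>2 + M"
  let ?e = "\<lambda>x. (sol m l x)\<^sup>2 + (dsol m l x)\<^sup>2"
  let ?g = "\<lambda>x. ?e x * exp (C * x)"
  have "?g 0 \<le> ?g x"
  proof (rule DERIV_nonneg_imp_nondecreasing[OF \<open>0 \<le> x\<close>])
    fix t assume t: "0 \<le> t" "t \<le> x"
    have "\<bar>1 + pot m t - l\<bar> \<le> C"
      using ode_coeff_bound[of m M l t x] assms t unfolding C_def M_def by simp
    then have "- ((1 + pot m t - l) * (2 * (sol m l t * dsol m l t))) \<le> C * ?e t"
      using cross_term_le[of "-(1 + pot m t - l)" C "sol m l t" "dsol m l t"]
      unfolding abs_minus_cancel mult_minus_left by blast
    then have "((1 + pot m t - l) * (2 * (sol m l t * dsol m l t)) + C * ?e t) * exp (C * t) \<ge> 0" by auto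
    moreover have "(?g has_real_derivative
        ((1 + pot m t - l) * (2 * (sol m l t * dsol m l t)) + C * ?e t) * exp (C * t)) (at t)"
      by (rule derivative_eq_intros sol_energy_has_deriv refl)+ (simp add: algebra_simps)
    ultimately show "\<exists>y. (?g has_real_derivative y) (at t) \<and> 0 \<le> y" by blast
  qed
  then have "?g x > 0" by simp
  then show ?thesis by (simp add: zero_less_mult_iff)
qed

text \<open>
Let \<open>W\<close> and \<open>k\<close> be the potential and the energy of the second solution. The difference \<open>d\<close> of the
solutions satisfies \<open>d'' = (W - k) d + ((W - k) - (V - l)) u\<close>. The forcing term is of order \<open>\<delta>\<close>, and
Gronwall applies to \<open>d\<^sup>2 + d'\<^sup>2\<close>, which vanishes at the origin.
\<close>

lemma sol_dependence_estimate:
  assumes x: "0 \<le> x" "x \<le> X" and M: "\<bar>m\<bar> \<le> M" "\<bar>l\<bar> \<le> M" "\<bar>m'\<bar> \<le> M" "\<bar>l'\<bar> \<le> M"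
    and \<delta>: "\<bar>m' - m\<bar> \<le> \<delta>" "\<bar>l' - l\<bar> \<le> \<delta>"
  shows "(sol m' l' x - sol m l x)\<^sup>2 + (dsol m' l' x - dsol m l x)\<^sup>2
    \<le> ((2 * M + 2 * X\<^sup>2 + 1) * \<delta>)\<^sup>2 * exp ((1 + (M + X\<^sup>2)\<^sup>2 + M) * X) * X
        * exp ((2 + (M + X\<^sup>2)\<^sup>2 + M) * X)"
proof -
  define C where "C = 2 + (M + X\<^sup>2)\<^sup>2 + M"
  define k where "k = ((2 * M + 2 * X\<^sup>2 + 1) * \<delta>)\<^sup>2 * exp ((1 + (M + X\<^sup>2)\<^sup>2 + M) * X)"
  have C: "C \<ge> 0" unfolding C_def using assms by auto
  have k: "k \<ge> 0" unfolding k_def by auto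
  let ?u = "sol m l" and ?v = "sol m' l'" and ?u' = "dsol m l" and ?v' = "dsol m' l'"
  let ?e = "\<lambda>x. (?v x - ?u x)\<^sup>2 + (?v' x - ?u' x)\<^sup>2"
  let ?p = "\<lambda>t. pot m t - l" and ?q = "\<lambda>t. pot m' t - l'"
  have "?e x \<le> (?e 0 + k * x) * exp (C * x)"
  proof (rule gronwall)
    fix t assume t: "0 \<le> t" "t \<le> x"
    show "(?e has_real_derivative (1 + ?q t) * (2 * ((?v t - ?u t) * (?v' t - ?u' t)))
             + 2 * ((?v' t - ?u' t) * ((?q t - ?p t) * ?u t))) (at t)"
      by (rule derivative_eq_intros refl)+ (simp add: algebra_simps)
    have 1: "\<bar>1 + ?q t\<bar> \<le> C - 1"
      using ode_coeff_bound[of m' M l' t X] assms t unfolding C_def by (simp add: add_diff_eq)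
    have 2: "(1 + ?q t) * (2 * ((?v t - ?u t) * (?v' t - ?u' t))) \<le> (C - 1) * ?e t"
      using 1 by (rule cross_term_le)
    have 3: "2 * ((?v' t - ?u' t) * ((?q t - ?p t) * ?u t)) \<le> (?v' t - ?u' t)\<^sup>2 + ((?q t - ?p t) * ?u t)\<^sup>2"
      by (rule two_mult_le)
    have "t\<^sup>2 \<le> X\<^sup>2" using t x by (intro power_mono) auto
    then have "\<bar>m' + m + 2 * t\<^sup>2\<bar> \<le> 2 * M + 2 * X\<^sup>2" using M zero_le_power2[of t] by linarith
    then have "\<bar>m' - m\<bar> * \<bar>m' + m + 2 * t\<^sup>2\<bar> \<le> \<delta> * (2 * M + 2 * X\<^sup>2)"
      using \<delta> by (intro mult_mono) auto
    moreover have "?q t - ?p t = (m' - m) * (m' + m + 2 * t\<^sup>2) - (l' - l)"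
      unfolding pot_def by (simp add: power2_eq_square algebra_simps)
    then have "\<bar>?q t - ?p t\<bar> \<le> \<bar>m' - m\<bar> * \<bar>m' + m + 2 * t\<^sup>2\<bar> + \<bar>l' - l\<bar>"
      by (metis abs_mult abs_triangle_ineq4)
    ultimately have "\<bar>?q t - ?p t\<bar> \<le> (2 * M + 2 * X\<^sup>2 + 1) * \<delta>"
      using \<delta> by (simp add: algebra_simps)
    then have 4: "(?q t - ?p t)\<^sup>2 \<le> ((2 * M + 2 * X\<^sup>2 + 1) * \<delta>)\<^sup>2"
      by (meson abs_le_square_iff abs_ge_self order.trans)
    have 5: "(?u t)\<^sup>2 \<le> exp ((1 + (M + X\<^sup>2)\<^sup>2 + M) * X)"
      using sol_energy_bound[of t X m M l] t x M zero_le_power2[of "?u' t"] by linarith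
    have "((?q t - ?p t) * ?u t)\<^sup>2 \<le> k"
      unfolding k_def power_mult_distrib using 4 5 by (intro mult_mono) (auto simp: power_mult_distrib)
    moreover have "(C - 1) * ?e t + (?v' t - ?u' t)\<^sup>2 \<le> C * ?e t" by (simp add: algebra_simps)
    ultimately show "(1 + ?q t) * (2 * ((?v t - ?u t) * (?v' t - ?u' t)))
             + 2 * ((?v' t - ?u' t) * ((?q t - ?p t) * ?u t)) \<le> C * ?e t + k"
      using 2 3 by linarith
  qed (use x C k in auto)
  also have "\<dots> \<le> k * X * exp (C * X)" using x C k by (auto intro!: mult_mono)
  finally show ?thesis unfolding k_def C_def .
qed

lemma sol_continuous_dependence:
  assumes "0 \<le> X" "\<epsilon> > 0"
  shows "\<exists>\<delta>>0. \<forall>m' l'. \<bar>m' - m\<bar> < \<delta> \<longrightarrow> \<bar>l' - l\<bar> < \<delta> \<longrightarrow>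
    (\<forall>x. 0 \<le> x \<longrightarrow> x \<le> X \<longrightarrow> \<bar>sol m' l' x - sol m l x\<bar> < \<epsilon> \<and> \<bar>dsol m' l' x - dsol m l x\<bar> < \<epsilon>)"
proof -
  define M where "M = \<bar>m\<bar> + \<bar>l\<bar> + 1"
  define K where "K = (2 * M + 2 * X\<^sup>2 + 1)\<^sup>2 * exp ((1 + (M + X\<^sup>2)\<^sup>2 + M) * X) * X
        * exp ((2 + (M + X\<^sup>2)\<^sup>2 + M) * X) + 1"
  have K: "K > 0" unfolding K_def using assms by (intro add_nonneg_pos) auto
  define \<delta> where "\<delta> = min 1 (\<epsilon> / (2 * K))"
  have K1: "K \<ge> 1" unfolding K_def using assms by auto
  have \<delta>: "\<delta> > 0" "\<delta> \<le> 1" "\<delta> \<le> \<epsilon> / (2 * K)" unfolding \<delta>_def using assms K by auto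
  show ?thesis
  proof (intro exI[of _ \<delta>] conjI allI impI \<delta>(1))
    fix m' l' x assume h: "\<bar>m' - m\<bar> < \<delta>" "\<bar>l' - l\<bar> < \<delta>" "0 \<le> x" "x \<le> X"
    have "(sol m' l' x - sol m l x)\<^sup>2 + (dsol m' l' x - dsol m l x)\<^sup>2 \<le> (K - 1) * \<delta>\<^sup>2"
    proof -
      have "\<bar>m'\<bar> \<le> M" "\<bar>l'\<bar> \<le> M" "\<bar>m\<bar> \<le> M" "\<bar>l\<bar> \<le> M" using h \<delta> unfolding M_def by linarith+
      from sol_dependence_estimate[OF h(3,4) this(3,4,1,2), of \<delta>] h
      have "(sol m' l' x - sol m l x)\<^sup>2 + (dsol m' l' x - dsol m l x)\<^sup>2
        \<le> ((2 * M + 2 * X\<^sup>2 + 1) * \<delta>)\<^sup>2 * exp ((1 + (M + X\<^sup>2)\<^sup>2 + M) * X) * X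
        * exp ((2 + (M + X\<^sup>2)\<^sup>2 + M) * X)" by simp
      also have "\<dots> = (K - 1) * \<delta>\<^sup>2" unfolding K_def by (simp add: power_mult_distrib mult_ac)
      finally show ?thesis .
    qed
    also have "\<dots> \<le> K\<^sup>2 * \<delta>\<^sup>2"
    proof -
      have "K * 1 \<le> K * K" using K K1 by (intro mult_left_mono) auto
      then show ?thesis by (intro mult_right_mono) (auto simp: power2_eq_square)
    qed
    also have "\<dots> \<le> K\<^sup>2 * (\<epsilon> / (2 * K))\<^sup>2" using \<delta> K by (intro mult_left_mono power_mono) auto
    also have "\<dots> = (\<epsilon> / 2)\<^sup>2" using K by (simp add: power2_eq_square field_simps)
    also have "\<dots> < \<epsilon>\<^sup>2" using assms by (simp add: power2_eq_square field_simps)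
    finally have *: "(sol m' l' x - sol m l x)\<^sup>2 + (dsol m' l' x - dsol m l x)\<^sup>2 < \<epsilon>\<^sup>2" .
    have "(sol m' l' x - sol m l x)\<^sup>2 < \<epsilon>\<^sup>2" "(dsol m' l' x - dsol m l x)\<^sup>2 < \<epsilon>\<^sup>2"
      using * zero_le_power2[of "dsol m' l' x - dsol m l x"] zero_le_power2[of "sol m' l' x - sol m l x"]
      by linarith+
    then show "\<bar>sol m' l' x - sol m l x\<bar> < \<epsilon>" "\<bar>dsol m' l' x - dsol m l x\<bar> < \<epsilon>"
      using assms abs_square_less_1 by (auto intro: power_less_imp_less_base[of _ 2])
  qed
qed

section \<open>Shooting: crossing, decaying and growing solutions\<close>

text \<open>
Requiring a negative value instead of a zero makes the condition visibly open in the parameters;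
zeros are simple, so nothing is lost (\<open>sol_pos_if_not_crossing\<close>).
\<close>

definition crossing :: "real \<Rightarrow> real \<Rightarrow> bool" where
  "crossing m l \<longleftrightarrow> (\<exists>x\<ge>0. sol m l x < 0)"

text \<open>
Once \<open>V \<ge> l + 1\<close>, a positive solution is convex. If its derivative is positive at some such point, the
solution grows from there on; otherwise it decays exponentially. The second conjunct selects the
latter alternative.
\<close>

definition decaying :: "real \<Rightarrow> real \<Rightarrow> bool" where
  "decaying m l \<longleftrightarrow> (\<forall>x\<ge>0. sol m l x > 0) \<and>
     (\<forall>x\<ge>0. (\<forall>y\<ge>x. l + 1 \<le> pot m y) \<longrightarrow> dsol m l x \<le> 0)"

text \<open>
A zero of a nonnegative solution would be a minimum and therefore a double zero.
\<close>

lemma sol_pos_if_not_crossing: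
  assumes "\<not> crossing m l"
  shows "sol m l x > 0"
proof -
  have nonneg: "sol m l y \<ge> 0" for y
    using assms unfolding crossing_def by (cases "y \<ge> 0") (force, metis linorder_not_le neg_0_le_iff_le order_less_imp_le sol_minus)
  have "sol m l y > 0" if "y \<ge> 0" for y
  proof (rule ccontr)
    assume "\<not> sol m l y > 0"
    then have 0: "sol m l y = 0" using nonneg[of y] by auto
    have "dsol m l y = 0"
      by (rule DERIV_local_min[OF sol_has_deriv, of 1]) (use nonneg 0 in auto)
    then show False using sol_dsol_not_both_zero[OF that, of m l] 0 by simp
  qed
  then show ?thesis by (metis linorder_le_cases neg_0_le_iff_le sol_minus)
qed

text \<open>
A threshold beyond which \<open>V \<ge> l + 1\<close>, uniform over a bounded set of parameters.
\<close>

lemma pot_large: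
  assumes "\<bar>m\<bar> \<le> M" "\<bar>l\<bar> \<le> M" "x \<ge> M + 2"
  shows "l + 1 \<le> pot m x"
proof -
  have "(M + 2) * (M + 2) \<le> x * x" using assms by (intro mult_mono) auto
  moreover have "(M + 2) * (M + 2) = M * M + 4 * M + 4" by (simp add: algebra_simps)
  moreover have "0 \<le> M * M" "0 \<le> M" using assms by auto
  ultimately have "M + 1 \<le> m + x\<^sup>2" using assms unfolding power2_eq_square by linarith
  then have "(M + 1) * 1 \<le> (m + x\<^sup>2) * (m + x\<^sup>2)" using assms by (intro mult_mono) auto
  moreover have "l + 1 \<le> (M + 1) * 1" using assms by simp
  ultimately show ?thesis unfolding pot_def power2_eq_square by (rule order.trans[rotated])
qed

text \<open>
The product \<open>u u'\<close> has derivative \<open>u'\<^sup>2 + (V - l) u\<^sup>2 \<ge> 0\<close>, so it stays positive and neither factor can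
change sign.
\<close>

lemma sol_growth:
  assumes "sol m l x0 > 0" "dsol m l x0 > 0" and V: "\<And>y. y \<ge> x0 \<Longrightarrow> l \<le> pot m y" and "x0 \<le> x"
  shows "sol m l x > 0" "dsol m l x > 0"
proof -
  let ?g = "\<lambda>x. sol m l x * dsol m l x"
  have g: "?g y > 0" if "y \<ge> x0" for y
  proof -
    have "?g x0 \<le> ?g y"
    proof (rule DERIV_nonneg_imp_nondecreasing[OF that])
      fix t assume "x0 \<le> t" "t \<le> y"
      then have "(dsol m l t)\<^sup>2 + (pot m t - l) * (sol m l t)\<^sup>2 \<ge> 0" using V[of t] by simp
      moreover have "(?g has_real_derivative (dsol m l t)\<^sup>2 + (pot m t - l) * (sol m l t)\<^sup>2) (at t)"
        by (rule derivative_eq_intros refl)+ (simp add: power2_eq_square algebra_simps)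
      ultimately show "\<exists>y. (?g has_real_derivative y) (at t) \<and> 0 \<le> y" by blast
    qed
    then show ?thesis using mult_pos_pos[OF assms(1,2)] by linarith
  qed
  show pos: "sol m l x > 0"
  proof (rule ccontr)
    assume "\<not> sol m l x > 0"
    then have "\<exists>y\<ge>x0. y \<le> x \<and> sol m l y = 0"
      using assms by (intro IVT2') (auto intro!: continuous_intros)
    then show False using g by force
  qed
  show "dsol m l x > 0" using g[OF \<open>x0 \<le> x\<close>] pos by (simp add: zero_less_mult_iff)
qed

text \<open>
If \<open>V \<ge> l\<close> everywhere then \<open>u\<close> is convex and at least \<open>1\<close>, so the energy of a decaying solution must
exceed the minimum of the potential. This gives the lower bounds on the ground state energy.
\<close>

lemma not_decaying_if_coeff_nonneg:
  assumes V: "\<And>y. l \<le> pot m y"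
  shows "\<not> crossing m l" "\<not> decaying m l"
proof -
  let ?g = "\<lambda>x. sol m l x * dsol m l x"
  have g: "?g y \<ge> 0" if "y \<ge> 0" for y
  proof -
    have "?g 0 \<le> ?g y"
    proof (rule DERIV_nonneg_imp_nondecreasing[OF that])
      fix t assume "0 \<le> t" "t \<le> y"
      then have "(dsol m l t)\<^sup>2 + (pot m t - l) * (sol m l t)\<^sup>2 \<ge> 0" using V[of t] by simp
      moreover have "(?g has_real_derivative (dsol m l t)\<^sup>2 + (pot m t - l) * (sol m l t)\<^sup>2) (at t)"
        by (rule derivative_eq_intros refl)+ (simp add: power2_eq_square algebra_simps)
      ultimately show "\<exists>y. (?g has_real_derivative y) (at t) \<and> 0 \<le> y" by blast
    qed
    then show ?thesis by simp
  qed
  have sq: "1 \<le> (sol m l y)\<^sup>2" if "y \<ge> 0" for y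
  proof -
    have "(sol m l 0)\<^sup>2 \<le> (sol m l y)\<^sup>2"
    proof (rule DERIV_nonneg_imp_nondecreasing[OF that])
      fix t assume "0 \<le> t" "t \<le> y"
      moreover have "((\<lambda>t. (sol m l t)\<^sup>2) has_real_derivative 2 * ?g t) (at t)"
        by (rule derivative_eq_intros refl)+ (simp add: power2_eq_square algebra_simps)
      ultimately show "\<exists>y. ((\<lambda>t. (sol m l t)\<^sup>2) has_real_derivative y) (at t) \<and> 0 \<le> y" using g by force
    qed
    then show ?thesis by simp
  qed
  have pos: "sol m l y > 0" if "y \<ge> 0" for y
  proof (rule ccontr)
    assume "\<not> sol m l y > 0"
    then have "\<exists>z\<ge>0. z \<le> y \<and> sol m l z = 0"
      using that by (intro IVT2') (auto intro!: continuous_intros)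
    then show False using sq by force
  qed
  show "\<not> crossing m l" unfolding crossing_def using pos by force
  show "\<not> decaying m l"
  proof
    assume D: "decaying m l"
    define X where "X = max \<bar>m\<bar> \<bar>l\<bar> + 2"
    have V1: "l + 1 \<le> pot m y" if "y \<ge> X" for y
      using pot_large[of m "max \<bar>m\<bar> \<bar>l\<bar>" l y] that unfolding X_def by auto
    have X0: "X \<ge> 0" unfolding X_def by auto
    have "dsol m l X < dsol m l (X + 1)"
    proof (rule DERIV_pos_imp_increasing[where f = "dsol m l"])
      fix t assume "X \<le> t" "t \<le> X + 1"
      then have "(pot m t - l) * sol m l t > 0" using V1[of t] pos[of t] X0 by auto
      then show "\<exists>y. (dsol m l has_real_derivative y) (at t) \<and> 0 < y" using dsol_has_deriv by blast
    qed auto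
    moreover have "dsol m l X \<ge> 0" using g[OF X0] pos[OF X0] by (simp add: zero_le_mult_iff)
    moreover have "dsol m l (X + 1) \<le> 0" using D V1 X0 unfolding decaying_def by auto
    ultimately show False by linarith
  qed
qed

lemma wronskian_has_deriv:
  "((\<lambda>x. dsol m l x * sol m' l' x - sol m l x * dsol m' l' x) has_real_derivative
     (pot m x - pot m' x - (l - l')) * (sol m l x * sol m' l' x)) (at x)"
  by (rule derivative_eq_intros refl)+ (simp add: algebra_simps)

text \<open>
Sturm comparison. If \<open>b\<close> solves the equation with the larger energy and is positive, then the
quotient \<open>a / b\<close> is nondecreasing as long as \<open>a\<close> is nonnegative, because the Wronskian
\<open>a' b - a b'\<close> has derivative \<open>(l' - l) a b\<close>. So \<open>a\<close> could never reach zero.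
\<close>

lemma crossing_mono:
  assumes "crossing m l" "l < l'"
  shows "crossing m l'"
proof (rule ccontr)
  assume n: "\<not> crossing m l'"
  note b = sol_pos_if_not_crossing[OF n]
  obtain x0 where x0: "x0 \<ge> 0" "sol m l x0 < 0" using assms unfolding crossing_def by blast
  define S where "S = {0..x0} \<inter> {x. sol m l x \<le> 0}"
  have "compact S" unfolding S_def
    by (intro compact_Int_closed closed_Collect_le continuous_intros) auto
  moreover have "S \<noteq> {}" unfolding S_def using x0 by auto
  ultimately obtain z where z: "z \<in> S" "\<And>t. t \<in> S \<Longrightarrow> z \<le> t"
    using compact_attains_inf[of S] by blast
  have z0: "z \<ge> 0" "sol m l z \<le> 0" using z unfolding S_def by auto
  have before: "sol m l t > 0" if "0 \<le> t" "t < z" for t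
    using z(2)[of t] that z(1) unfolding S_def by force
  let ?W = "\<lambda>x. dsol m l x * sol m l' x - sol m l x * dsol m l' x"
  have W: "?W t \<ge> 0" if "0 \<le> t" "t \<le> z" for t
  proof -
    have "?W 0 \<le> ?W t"
    proof (rule DERIV_nonneg_imp_increasing_open[OF \<open>0 \<le> t\<close>])
      fix s assume s: "0 < s" "s < t"
      then have "(pot m s - pot m s - (l - l')) * (sol m l s * sol m l' s) \<ge> 0"
        using before[of s] b[of s] that assms(2) by (auto intro!: mult_nonneg_nonneg)
      then show "\<exists>y. (?W has_real_derivative y) (at s) \<and> 0 \<le> y" using wronskian_has_deriv by blast
    qed (intro continuous_intros)
    then show ?thesis by simp
  qed
  have "sol m l 0 / sol m l' 0 \<le> sol m l z / sol m l' z"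
  proof (rule DERIV_nonneg_imp_nondecreasing[OF z0(1)])
    fix t assume t: "0 \<le> t" "t \<le> z"
    have "((\<lambda>x. sol m l x / sol m l' x) has_real_derivative ?W t / (sol m l' t)\<^sup>2) (at t)"
      using b[of t] by (auto intro!: derivative_eq_intros simp: power2_eq_square)
    moreover have "?W t / (sol m l' t)\<^sup>2 \<ge> 0" using W[OF t] by simp
    ultimately show "\<exists>y. ((\<lambda>x. sol m l x / sol m l' x) has_real_derivative y) (at t) \<and> 0 \<le> y" by blast
  qed
  then have "1 \<le> sol m l z / sol m l' z" by simp
  then show False using z0(2) b[of z] by (simp add: field_simps)
qed

text \<open>
A positive solution on \<open>[a, a + 1]\<close> is compared with \<open>sin (\<pi> (x - a))\<close>: if \<open>l - V > \<pi>\<^sup>2\<close> there, the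
solution oscillates faster than the sine and must vanish between its zeros. This bounds the ground
state energy from above and shows that crossing occurs at all.
\<close>

lemma not_crossing_le:
  assumes n: "\<not> crossing m l" and V: "\<And>x. a \<le> x \<Longrightarrow> x \<le> a + 1 \<Longrightarrow> pot m x \<le> K"
  shows "l \<le> pi\<^sup>2 + K"
proof (rule ccontr)
  assume l: "\<not> l \<le> pi\<^sup>2 + K"
  let ?W = "\<lambda>x. sol m l x * (pi * cos (pi * (x - a))) - dsol m l x * sin (pi * (x - a))"
  have "?W a \<le> ?W (a + 1)"
  proof (rule DERIV_nonneg_imp_nondecreasing[where f = ?W])
    fix t assume t: "a \<le> t" "t \<le> a + 1"
    have "(?W has_real_derivative sol m l t * sin (pi * (t - a)) * (l - pot m t - pi\<^sup>2)) (at t)"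
      by (rule derivative_eq_intros refl)+ (simp add: algebra_simps power2_eq_square)
    moreover have "sin (pi * (t - a)) \<ge> 0"
      using t by (intro sin_ge_zero) (auto intro!: mult_nonneg_nonneg mult_left_le)
    then have "sol m l t * sin (pi * (t - a)) * (l - pot m t - pi\<^sup>2) \<ge> 0"
      using sol_pos_if_not_crossing[OF n, of t] V[OF t] l by (intro mult_nonneg_nonneg) auto
    ultimately show "\<exists>y. (?W has_real_derivative y) (at t) \<and> 0 \<le> y" by blast
  qed simp
  then have "sol m l a * pi \<le> - (sol m l (a + 1) * pi)" by simp
  moreover have "sol m l a * pi > 0" "sol m l (a + 1) * pi > 0"
    using sol_pos_if_not_crossing[OF n] by auto
  ultimately show False by linarith
qed

lemma crossing_open:
  assumes "crossing m l"
  shows "\<exists>\<delta>>0. \<forall>m' l'. \<bar>m' - m\<bar> < \<delta> \<longrightarrow> \<bar>l' - l\<bar> < \<delta> \<longrightarrow> crossing m' l'"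
proof -
  obtain x where x: "x \<ge> 0" "sol m l x < 0" using assms unfolding crossing_def by blast
  then have "- sol m l x > 0" by simp
  from sol_continuous_dependence[OF x(1) this, of m l] obtain \<delta> where \<delta>: "\<delta> > 0"
    "\<And>m' l'. \<bar>m' - m\<bar> < \<delta> \<Longrightarrow> \<bar>l' - l\<bar> < \<delta> \<Longrightarrow> \<bar>sol m' l' x - sol m l x\<bar> < - sol m l x"
    using x(1) by blast
  have "crossing m' l'" if "\<bar>m' - m\<bar> < \<delta>" "\<bar>l' - l\<bar> < \<delta>" for m' l'
  proof -
    have "sol m' l' x < 0" using \<delta>(2)[OF that] by linarith
    then show ?thesis unfolding crossing_def using x(1) by blast
  qed
  then show ?thesis using \<delta>(1) by blast
qed

text \<open>
A growing solution is recognized at a finite point: positivity up to some \<open>x2\<close> in the region where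
\<open>V \<ge> l + 1\<close> for all nearby parameters, and positive derivative at \<open>x2\<close>. Both survive small changes of
the parameters, and from \<open>x2\<close> on growth is automatic.
\<close>

lemma growing_open:
  assumes "\<not> crossing m l" "\<not> decaying m l"
  shows "\<exists>\<delta>>0. \<forall>m' l'. \<bar>m' - m\<bar> < \<delta> \<longrightarrow> \<bar>l' - l\<bar> < \<delta> \<longrightarrow> \<not> crossing m' l'"
proof -
  note pos = sol_pos_if_not_crossing[OF assms(1)]
  obtain x1 where x1: "x1 \<ge> 0" "\<And>y. y \<ge> x1 \<Longrightarrow> l + 1 \<le> pot m y" "dsol m l x1 > 0"
    using assms(2) pos unfolding decaying_def by force
  define M where "M = \<bar>m\<bar> + \<bar>l\<bar> + 1"
  (* The growth at x1 is carried on to a point that is good for all nearby parameters. *)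
  define x2 where "x2 = max x1 (M + 2)"
  have x2: "x2 \<ge> x1" "x2 \<ge> M + 2" "x2 \<ge> 0" unfolding x2_def using x1 by auto
  have d2: "dsol m l x2 > 0" by (rule sol_growth(2)[of m l x1]) (use x1 x2 pos in force)+
  obtain z where z: "\<And>x. 0 \<le> x \<Longrightarrow> x \<le> x2 \<Longrightarrow> sol m l z \<le> sol m l x"
  proof -
    have "continuous_on {0..x2} (sol m l)" by (intro continuous_intros continuous_on_id)
    then show ?thesis
      using continuous_attains_inf[of "{0..x2}" "sol m l"] x2(3) that by (metis atLeastAtMost_iff atLeastatMost_empty_iff2 compact_Icc linorder_not_le)
  qed
  define \<epsilon> where "\<epsilon> = min (sol m l z) (dsol m l x2)"
  have \<epsilon>: "\<epsilon> > 0" unfolding \<epsilon>_def using pos d2 by auto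
  obtain \<delta> where \<delta>: "\<delta> > 0" and close: "\<And>m' l' x. \<bar>m' - m\<bar> < \<delta> \<Longrightarrow> \<bar>l' - l\<bar> < \<delta> \<Longrightarrow> 0 \<le> x \<Longrightarrow> x \<le> x2 \<Longrightarrow>
      \<bar>sol m' l' x - sol m l x\<bar> < \<epsilon> \<and> \<bar>dsol m' l' x - dsol m l x\<bar> < \<epsilon>"
    using sol_continuous_dependence[OF x2(3) \<epsilon>, of m l] by blast
  show ?thesis
  proof (intro exI[of _ "min \<delta> 1"] conjI allI impI)
    show "min \<delta> 1 > 0" using \<delta> by simp
    fix m' l' assume h: "\<bar>m' - m\<bar> < min \<delta> 1" "\<bar>l' - l\<bar> < min \<delta> 1"
    have 1: "sol m' l' x > 0" if "0 \<le> x" "x \<le> x2" for x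
      using close[of m' l' x] z[of x] that h unfolding \<epsilon>_def by auto
    have 2: "dsol m' l' x2 > 0" using close[of m' l' x2] h x2 unfolding \<epsilon>_def by auto
    have "\<bar>m'\<bar> \<le> M" "\<bar>l'\<bar> \<le> M" using h unfolding M_def by linarith+
    then have V: "l' \<le> pot m' y" if "y \<ge> x2" for y
      using pot_large[of m' M l' y] that x2 by auto
    have "sol m' l' x > 0" if "0 \<le> x" for x
    proof (cases "x \<le> x2")
      case False
      then show ?thesis using sol_growth(1)[of m' l' x2 x] 1[of x2] 2 V x2 by auto
    qed (use 1 that in auto)
    then show "\<not> crossing m' l'" unfolding crossing_def by force
  qed
qed

text \<open>
The crossing energies form an upper ray by \<open>crossing_mono\<close>, and this is its left end.
\<close>

definition ground :: "real \<Rightarrow> real" where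
  "ground m = Inf {l. crossing m l}"

lemma crossing_pos: "crossing m l \<Longrightarrow> l > 0"
  using not_decaying_if_coeff_nonneg(1)[of l m] pot_nonneg[of m] by (meson order.trans linorder_not_le)

lemma ground_lower: "crossing m l \<Longrightarrow> ground m \<le> l"
  unfolding ground_def using crossing_pos by (intro cInf_lower) (auto intro!: bdd_belowI[of _ 0] less_imp_le)

lemma crossing_above_ground:
  assumes "ground m < l" shows "crossing m l"
proof -
  have "crossing m (pi\<^sup>2 + (\<bar>m\<bar> + 1\<^sup>2)\<^sup>2 + 1)"
  proof (rule ccontr)
    assume "\<not> ?thesis"
    from not_crossing_le[OF this, of 0 "(\<bar>m\<bar> + 1\<^sup>2)\<^sup>2"] show False
      using pot_bound[of m "\<bar>m\<bar>" _ 1] by auto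
  qed
  then obtain l0 where "crossing m l0" "l0 < l"
    using cInf_lessD[of "{l. crossing m l}" l] assms unfolding ground_def by blast
  then show ?thesis using crossing_mono by blast
qed

lemma ground_not_crossing: "\<not> crossing m (ground m)"
proof
  assume "crossing m (ground m)"
  from crossing_open[OF this] obtain \<delta> where "\<delta> > 0" "crossing m (ground m - \<delta> / 2)" by fastforce
  then show False using ground_lower[of m "ground m - \<delta> / 2"] by simp
qed

text \<open>
At the threshold the solution can be neither crossing nor growing, since both are open conditions.
\<close>

lemma ground_decaying: "decaying m (ground m)"
proof (rule ccontr)
  assume "\<not> ?thesis"
  from growing_open[OF ground_not_crossing this] obtain \<delta> where "\<delta> > 0" "\<not> crossing m (ground m + \<delta> / 2)"
    by fastforce
  then show False using crossing_above_ground[of m "ground m + \<delta> / 2"] by simp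
qed

lemma decaying_pos: "decaying m l \<Longrightarrow> sol m l x > 0"
  by (rule sol_pos_if_not_crossing) (force simp: decaying_def crossing_def)

text \<open>
Where \<open>V \<ge> l + 1\<close>, a decaying solution satisfies \<open>u' \<le> - u\<close>: otherwise \<open>(u + u') exp (- x)\<close>, which is
nondecreasing, would be positive somewhere, and \<open>u\<close> would grow exponentially. The bound on \<open>u'\<close>
follows from that on \<open>u\<close> by the mean value theorem, because \<open>u'\<close> is nondecreasing.
\<close>

lemma decaying_exp_bound:
  assumes D: "decaying m l" and X: "X \<ge> 0" "\<And>y. y \<ge> X \<Longrightarrow> l + 1 \<le> pot m y" and x: "x \<ge> X"
  shows "sol m l x \<le> sol m l X * exp (X - x)"
    and "x \<ge> X + 1 \<Longrightarrow> \<bar>dsol m l x\<bar> \<le> sol m l X * exp (X + 1 - x)"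
proof -
  note pos = decaying_pos[OF D]
  have d: "dsol m l y \<le> 0" if "y \<ge> X" for y
    using D X that unfolding decaying_def by (meson order.trans)
  have less: "dsol m l x0 \<le> - sol m l x0" if x0: "x0 \<ge> X" for x0
  proof (rule ccontr)
    assume "\<not> ?thesis"
    then have s0: "sol m l x0 + dsol m l x0 > 0" (is "?s0 > 0") by simp
    (* At this point the linear part of the exponential alone exceeds u x0. *)
    define x where "x = x0 + sol m l x0 / ?s0"
    have x: "x \<ge> x0" unfolding x_def using s0 pos[of x0] by simp
    let ?g = "\<lambda>x. (sol m l x + dsol m l x) * exp (- x)"
    have "?g x0 \<le> ?g x"
    proof (rule DERIV_nonneg_imp_nondecreasing[OF x])
      fix t assume "x0 \<le> t" "t \<le> x"
      then have "(pot m t - l - 1) * sol m l t * exp (- t) \<ge> 0" using X(2)[of t] pos[of t] x0 by simp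
      moreover have "(?g has_real_derivative (pot m t - l - 1) * sol m l t * exp (- t)) (at t)"
        by (rule derivative_eq_intros refl)+ (simp add: algebra_simps)
      ultimately show "\<exists>y. (?g has_real_derivative y) (at t) \<and> 0 \<le> y" by blast
    qed
    then have "?g x0 * exp x \<le> ?g x * exp x" by (intro mult_right_mono) auto
    then have "?s0 * exp (x - x0) \<le> sol m l x + dsol m l x"
      by (simp add: mult.assoc flip: exp_add)
    also have "\<dots> \<le> sol m l x" using d[of x] x x0 by simp
    also have "\<dots> \<le> sol m l x0"
    proof (rule DERIV_nonpos_imp_nonincreasing[OF x])
      fix t assume "x0 \<le> t" "t \<le> x"
      then show "\<exists>y. (sol m l has_real_derivative y) (at t) \<and> y \<le> 0" using d[of t] x0 sol_has_deriv[of m l t] by force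
    qed
    finally have "?s0 * exp (x - x0) \<le> sol m l x0" .
    moreover have "?s0 * exp (x - x0) \<ge> ?s0 * (1 + (x - x0))" using s0 by (intro mult_left_mono exp_ge_add_one_self) auto
    moreover have "?s0 * (1 + (x - x0)) = ?s0 + sol m l x0" unfolding x_def using s0 by (simp add: field_simps)
    ultimately show False using s0 by linarith
  qed
  have *: "sol m l x \<le> sol m l X * exp (X - x)" if "x \<ge> X" for x
  proof -
    have "sol m l x * exp x \<le> sol m l X * exp X"
    proof (rule DERIV_nonpos_imp_nonincreasing[OF that])
      fix t assume "X \<le> t" "t \<le> x"
      then have "(dsol m l t + sol m l t) * exp t \<le> 0" using less[of t] by (simp add: mult_le_0_iff)
      moreover have "((\<lambda>x. sol m l x * exp x) has_real_derivative (dsol m l t + sol m l t) * exp t) (at t)"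
        by (rule derivative_eq_intros refl)+ (simp add: algebra_simps)
      ultimately show "\<exists>y. ((\<lambda>x. sol m l x * exp x) has_real_derivative y) (at t) \<and> y \<le> 0" by blast
    qed
    then have "sol m l x * exp x * exp (- x) \<le> sol m l X * exp X * exp (- x)" by (intro mult_right_mono) auto
    then show ?thesis by (simp add: mult.assoc flip: exp_add)
  qed
  show "sol m l x \<le> sol m l X * exp (X - x)" by (rule *[OF x])
  show "\<bar>dsol m l x\<bar> \<le> sol m l X * exp (X + 1 - x)" if x1: "x \<ge> X + 1"
  proof -
    obtain z where z: "x - 1 < z" "z < x" "sol m l x - sol m l (x - 1) = (x - (x - 1)) * dsol m l z"
      using MVT2[of "x - 1" x "sol m l" "dsol m l"] sol_has_deriv by auto
    have "dsol m l z \<le> dsol m l x"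
    proof (rule DERIV_nonneg_imp_nondecreasing[where f = "dsol m l"])
      fix t assume "z \<le> t" "t \<le> x"
      then have "(pot m t - l) * sol m l t \<ge> 0" using X(2)[of t] pos[of t] z x1 by simp
      then show "\<exists>y. (dsol m l has_real_derivative y) (at t) \<and> 0 \<le> y" using dsol_has_deriv by blast
    qed (use z in auto)
    then have "- dsol m l x \<le> sol m l (x - 1)" using z pos[of x] by simp
    then show ?thesis using *[of "x - 1"] d[of x] x1 by (simp add: algebra_simps)
  qed
qed

text \<open>
The constant depends only on the size of the parameters. This uniformity is what dominated
convergence needs when the parameter varies.
\<close>

lemma decaying_uniform_bound:
  "\<exists>C>0. \<forall>m l x. \<bar>m\<bar> \<le> M \<longrightarrow> \<bar>l\<bar> \<le> M \<longrightarrow> decaying m l \<longrightarrow> 0 \<le> x \<longrightarrow>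
     \<bar>sol m l x\<bar> \<le> C * exp (- x) \<and> \<bar>dsol m l x\<bar> \<le> C * exp (- x)"
proof -
  define X where "X = M + 2"
  define B where "B = exp ((1 + (M + (X + 1)\<^sup>2)\<^sup>2 + M) * (X + 1))"
  have key: "\<bar>sol m l x\<bar> \<le> B * exp (X + 1) * exp (- x) \<and> \<bar>dsol m l x\<bar> \<le> B * exp (X + 1) * exp (- x)"
    if h: "\<bar>m\<bar> \<le> M" "\<bar>l\<bar> \<le> M" "decaying m l" "0 \<le> x" for m l x
  proof -
    have X0: "X \<ge> 0" unfolding X_def using h by auto
    have B1: "B \<ge> 1" unfolding B_def using h X0 by auto
    have early: "\<bar>sol m l y\<bar> \<le> B \<and> \<bar>dsol m l y\<bar> \<le> B" if "0 \<le> y" "y \<le> X + 1" for y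
    proof -
      have "(sol m l y)\<^sup>2 + (dsol m l y)\<^sup>2 \<le> B"
        using sol_energy_bound[of y "X + 1" m M l] that h unfolding B_def by auto
      also have "B * 1 \<le> B * B" using B1 by (intro mult_left_mono) auto
      finally have "(sol m l y)\<^sup>2 + (dsol m l y)\<^sup>2 \<le> B\<^sup>2" by (simp add: power2_eq_square)
      then have "(sol m l y)\<^sup>2 \<le> B\<^sup>2" "(dsol m l y)\<^sup>2 \<le> B\<^sup>2"
        using zero_le_power2[of "sol m l y"] zero_le_power2[of "dsol m l y"] by linarith+
      then show ?thesis using B1 by (auto intro: power2_le_imp_le simp: abs_le_square_iff)
    qed
    have V: "l + 1 \<le> pot m y" if "y \<ge> X" for y using pot_large[of m M l y] h that unfolding X_def by auto
    show ?thesis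
    proof (cases "x \<le> X + 1")
      case True
      have "B * 1 \<le> B * exp (X + 1 - x)" using True B1 by (intro mult_left_mono) auto
      then show ?thesis using early[of x] h True by (simp add: mult.assoc flip: exp_add)
    next
      case False
      have "sol m l X * exp (X - x) \<le> B * exp (X + 1 - x)" "sol m l X * exp (X + 1 - x) \<le> B * exp (X + 1 - x)"
        using early[of X] X0 decaying_pos[OF h(3), of X] B1 by (auto intro!: mult_mono)
      then have "\<bar>sol m l x\<bar> \<le> B * exp (X + 1 - x)" "\<bar>dsol m l x\<bar> \<le> B * exp (X + 1 - x)"
        using decaying_exp_bound[OF h(3) X0 V, of x] False decaying_pos[OF h(3), of x] by linarith+
      then show ?thesis by (simp add: mult.assoc flip: exp_add)
    qed
  qed
  show ?thesis by (rule exI[of _ "B * exp (X + 1)"]) (use key in \<open>auto simp: B_def\<close>)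
qed

lemma decaying_bound:
  assumes "decaying m l"
  obtains C where "C > 0" "\<And>x. x \<ge> 0 \<Longrightarrow> \<bar>sol m l x\<bar> \<le> C * exp (- x)" "\<And>x. x \<ge> 0 \<Longrightarrow> \<bar>dsol m l x\<bar> \<le> C * exp (- x)"
  using decaying_uniform_bound[of "max \<bar>m\<bar> \<bar>l\<bar>"] assms by (metis max.cobounded1 max.cobounded2)

section \<open>Integrals over the half line\<close>

definition half_int :: "(real \<Rightarrow> real) \<Rightarrow> real" where
  "half_int f = (LINT x|lborel. f x * indicator {0..} x)"

text \<open>
A class of integrands that contains all products of two ground states or their derivatives and is
closed under multiplication by polynomials. The rate \<open>exp (- 2 x)\<close> is that of such a product; the
power of \<open>1 + x\<close> absorbs the polynomials.
\<close>

definition rapid :: "(real \<Rightarrow> real) \<Rightarrow> bool" where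
  "rapid f \<longleftrightarrow> continuous_on UNIV f \<and> (\<exists>C n. \<forall>x\<ge>0. \<bar>f x\<bar> \<le> C * (1 + x) ^ n * exp (- 2 * x))"

lemma power_le_fact_exp:
  fixes x :: real assumes "x \<ge> 0" shows "x ^ n \<le> fact n * exp x"
proof -
  have "(\<Sum>k\<in>{n}. inverse (fact k) * x ^ k) \<le> (\<Sum>k. inverse (fact k) * x ^ k)"
    using assms by (intro sum_le_suminf summable_exp) auto
  then show ?thesis by (simp add: exp_def field_simps)
qed

lemma rapid_le_exp:
  assumes "rapid f"
  obtains C where "C > 0" "\<And>x. x \<ge> 0 \<Longrightarrow> \<bar>f x\<bar> \<le> C * exp (- x)"
proof -
  obtain C n where C: "\<And>x. x \<ge> 0 \<Longrightarrow> \<bar>f x\<bar> \<le> C * (1 + x) ^ n * exp (- 2 * x)"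
    using assms unfolding rapid_def by blast
  show thesis
  proof (rule that[of "\<bar>C\<bar> * (fact n * exp 1) + 1"])
    fix x :: real assume x: "x \<ge> 0"
    have "\<bar>f x\<bar> \<le> C * (1 + x) ^ n * exp (- 2 * x)" by (rule C[OF x])
    also have "\<dots> \<le> \<bar>C\<bar> * (fact n * exp (1 + x)) * exp (- 2 * x)"
      using power_le_fact_exp[of "1 + x" n] x by (intro mult_right_mono mult_mono) auto
    also have "\<dots> = \<bar>C\<bar> * (fact n * exp 1) * exp (- x)" by (simp add: mult.assoc flip: exp_add)
    also have "\<dots> \<le> (\<bar>C\<bar> * (fact n * exp 1) + 1) * exp (- x)" by (intro mult_right_mono) auto
    finally show "\<bar>f x\<bar> \<le> (\<bar>C\<bar> * (fact n * exp 1) + 1) * exp (- x)" .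
  qed (auto intro!: add_nonneg_pos)
qed

lemma rapid_continuous: "rapid f \<Longrightarrow> continuous_on A f"
  unfolding rapid_def by (metis continuous_on_subset subset_UNIV)

lemma rapid_bound:
  assumes "rapid f" "continuous_on UNIV g" "\<And>x. x \<ge> 0 \<Longrightarrow> \<bar>g x\<bar> \<le> \<bar>f x\<bar>"
  shows "rapid g"
  using assms unfolding rapid_def by (meson order.trans)

lemma rapid_add [intro]:
  assumes "rapid f" "rapid g" shows "rapid (\<lambda>x. f x + g x)"
proof -
  obtain C n where C: "\<And>x. x \<ge> 0 \<Longrightarrow> \<bar>f x\<bar> \<le> C * (1 + x) ^ n * exp (- 2 * x)"
    using assms unfolding rapid_def by blast
  obtain D k where D: "\<And>x. x \<ge> 0 \<Longrightarrow> \<bar>g x\<bar> \<le> D * (1 + x) ^ k * exp (- 2 * x)"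
    using assms unfolding rapid_def by blast
  have "\<bar>f x + g x\<bar> \<le> (\<bar>C\<bar> + \<bar>D\<bar>) * (1 + x) ^ (n + k) * exp (- 2 * x)" if x: "x \<ge> 0" for x
  proof -
    have "C * (1 + x) ^ n * exp (- 2 * x) \<le> \<bar>C\<bar> * (1 + x) ^ (n + k) * exp (- 2 * x)"
      using x by (intro mult_right_mono mult_mono power_increasing) auto
    moreover have "D * (1 + x) ^ k * exp (- 2 * x) \<le> \<bar>D\<bar> * (1 + x) ^ (n + k) * exp (- 2 * x)"
      using x by (intro mult_right_mono mult_mono power_increasing) auto
    ultimately show ?thesis using C[OF x] D[OF x] abs_triangle_ineq[of "f x" "g x"]
      unfolding distrib_right by linarith
  qed
  moreover have "continuous_on UNIV (\<lambda>x. f x + g x)" using assms by (intro continuous_intros rapid_continuous)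
  ultimately show ?thesis unfolding rapid_def by blast
qed

lemma rapid_cmult [intro]:
  assumes "rapid f" shows "rapid (\<lambda>x. c * f x)"
proof -
  obtain C n where C: "\<And>x. x \<ge> 0 \<Longrightarrow> \<bar>f x\<bar> \<le> C * (1 + x) ^ n * exp (- 2 * x)"
    using assms unfolding rapid_def by blast
  have "\<bar>c * f x\<bar> \<le> (\<bar>c\<bar> * C) * (1 + x) ^ n * exp (- 2 * x)" if "x \<ge> 0" for x
    using mult_left_mono[OF C[OF that], of "\<bar>c\<bar>"] by (simp add: abs_mult mult_ac)
  moreover have "continuous_on UNIV (\<lambda>x. c * f x)" using assms by (intro continuous_intros rapid_continuous)
  ultimately show ?thesis unfolding rapid_def by blast
qed

lemma rapid_minus [intro]: "rapid f \<Longrightarrow> rapid (\<lambda>x. - f x)"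
  using rapid_cmult[of f "-1"] by simp

lemma rapid_diff [intro]: "rapid f \<Longrightarrow> rapid g \<Longrightarrow> rapid (\<lambda>x. f x - g x)"
  using rapid_add[of f "\<lambda>x. - g x"] by auto

lemma rapid_xmult [intro]:
  assumes "rapid f" shows "rapid (\<lambda>x. x * f x)"
proof -
  obtain C n where C: "\<And>x. x \<ge> 0 \<Longrightarrow> \<bar>f x\<bar> \<le> C * (1 + x) ^ n * exp (- 2 * x)"
    using assms unfolding rapid_def by blast
  have "\<bar>x * f x\<bar> \<le> C * (1 + x) ^ Suc n * exp (- 2 * x)" if x: "x \<ge> 0" for x
  proof -
    have "\<bar>x * f x\<bar> \<le> (1 + x) * (C * (1 + x) ^ n * exp (- 2 * x))"
      unfolding abs_mult using C[OF x] x by (intro mult_mono) auto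
    then show ?thesis by (simp add: mult_ac)
  qed
  moreover have "continuous_on UNIV (\<lambda>x. x * f x)" using assms by (intro continuous_intros rapid_continuous)
  ultimately show ?thesis unfolding rapid_def by blast
qed

lemma rapid_x2mult [intro]: "rapid f \<Longrightarrow> rapid (\<lambda>x. x\<^sup>2 * f x)"
  using rapid_xmult[OF rapid_xmult, of f] by (simp add: power2_eq_square mult.assoc)

lemma rapid_quadratic_mult [intro]: "rapid f \<Longrightarrow> rapid (\<lambda>x. (a + b * x\<^sup>2) * f x)"
  using rapid_add[OF rapid_cmult[of f a] rapid_cmult[OF rapid_x2mult, of f b]] by (simp add: algebra_simps)

lemma rapid_shift_mult [intro]: "rapid f \<Longrightarrow> rapid (\<lambda>x. (a + x\<^sup>2) * f x)"
  using rapid_quadratic_mult[of f a 1] by simp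

lemma rapid_pot_mult [intro]:
  assumes "rapid f" shows "rapid (\<lambda>x. pot m x * f x)"
  using rapid_shift_mult[OF rapid_shift_mult[OF assms, of m], of m]
  by (simp add: pot_def power2_eq_square mult.assoc)

lemma rapid_product:
  assumes f: "continuous_on UNIV f" "\<And>x. x \<ge> 0 \<Longrightarrow> \<bar>f x\<bar> \<le> C * exp (- x)"
    and g: "continuous_on UNIV g" "\<And>x. x \<ge> 0 \<Longrightarrow> \<bar>g x\<bar> \<le> D * exp (- x)"
  shows "rapid (\<lambda>x. f x * g x)"
proof -
  have "\<bar>f x * g x\<bar> \<le> (C * D) * (1 + x) ^ 0 * exp (- 2 * x)" if x: "x \<ge> 0" for x
  proof -
    have "C * exp (- x) \<ge> 0" using f(2)[OF x] by linarith
    then have "\<bar>f x * g x\<bar> \<le> (C * exp (- x)) * (D * exp (- x))"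
      unfolding abs_mult using f(2)[OF x] g(2)[OF x] by (intro mult_mono) auto
    also have "\<dots> = C * D * exp (- 2 * x)" by (simp add: mult_ac flip: exp_add)
    finally show ?thesis by simp
  qed
  moreover have "continuous_on UNIV (\<lambda>x. f x * g x)" using f g by (intro continuous_intros)
  ultimately show ?thesis unfolding rapid_def by blast
qed

lemma rapid_sol_products:
  assumes "decaying m l" "decaying n k"
  shows "rapid (\<lambda>x. sol m l x * sol n k x)" "rapid (\<lambda>x. sol m l x * dsol n k x)"
    "rapid (\<lambda>x. dsol m l x * sol n k x)" "rapid (\<lambda>x. dsol m l x * dsol n k x)"
proof -
  obtain C where C: "\<And>x. x \<ge> 0 \<Longrightarrow> \<bar>sol m l x\<bar> \<le> C * exp (- x)" "\<And>x. x \<ge> 0 \<Longrightarrow> \<bar>dsol m l x\<bar> \<le> C * exp (- x)"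
    using decaying_bound[OF assms(1)] by metis
  obtain D where D: "\<And>x. x \<ge> 0 \<Longrightarrow> \<bar>sol n k x\<bar> \<le> D * exp (- x)" "\<And>x. x \<ge> 0 \<Longrightarrow> \<bar>dsol n k x\<bar> \<le> D * exp (- x)"
    using decaying_bound[OF assms(2)] by metis
  show "rapid (\<lambda>x. sol m l x * sol n k x)" "rapid (\<lambda>x. sol m l x * dsol n k x)"
    "rapid (\<lambda>x. dsol m l x * sol n k x)" "rapid (\<lambda>x. dsol m l x * dsol n k x)"
    using C D by (auto intro!: rapid_product continuous_intros)
qed

lemma integrable_exp_half: "integrable lborel (\<lambda>x. exp (- x) * indicator {0..} x :: real)"
proof (rule integrableI_nonneg)
  have "((\<lambda>x::real. exp (- x)) \<longlongrightarrow> 0) at_top"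
    by (rule filterlim_compose[OF exp_at_bot filterlim_uminus_at_bot_at_top])
  from tendsto_minus[OF this]
  have "(\<integral>\<^sup>+ x. ennreal (exp (- x)) * indicator {0..} x \<partial>lborel) = ennreal (- 0 - (- exp (- 0 :: real)))"
    by (intro nn_integral_FTC_atLeast[where F = "\<lambda>x. - exp (- x)"])
      (auto intro!: derivative_eq_intros)
  moreover have "ennreal (exp (- x) * indicator {0..} x) = ennreal (exp (- x)) * indicator {0..} x" for x :: real
    by (auto simp: indicator_def)
  ultimately show "(\<integral>\<^sup>+ x. ennreal (exp (- x) * indicator {0..} x) \<partial>lborel) < \<infinity>" by simp
qed (auto simp: indicator_def)

lemma half_int_integrable:
  assumes "rapid f" shows "integrable lborel (\<lambda>x. f x * indicator {0..} x)"
proof -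
  obtain C where C: "C > 0" "\<And>x. x \<ge> 0 \<Longrightarrow> \<bar>f x\<bar> \<le> C * exp (- x)" using rapid_le_exp[OF assms] by metis
  have [measurable]: "f \<in> borel_measurable borel"
    using rapid_continuous[OF assms] by (intro borel_measurable_continuous_onI)
  show ?thesis
    by (rule Bochner_Integration.integrable_bound[OF integrable_mult_right[OF integrable_exp_half, of C]])
      (use C in \<open>auto simp: indicator_def intro!: AE_I2 split: if_splits\<close>)
qed

lemma half_int_add: "rapid f \<Longrightarrow> rapid g \<Longrightarrow> half_int (\<lambda>x. f x + g x) = half_int f + half_int g"
  unfolding half_int_def distrib_right by (intro Bochner_Integration.integral_add half_int_integrable)

lemma half_int_diff: "rapid f \<Longrightarrow> rapid g \<Longrightarrow> half_int (\<lambda>x. f x - g x) = half_int f - half_int g"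
  unfolding half_int_def left_diff_distrib by (intro Bochner_Integration.integral_diff half_int_integrable)

lemma half_int_cmult: "half_int (\<lambda>x. c * f x) = c * half_int f"
  unfolding half_int_def mult.assoc by simp

lemma half_int_nonneg: "(\<And>x. x \<ge> 0 \<Longrightarrow> f x \<ge> 0) \<Longrightarrow> half_int f \<ge> 0"
  unfolding half_int_def by (intro integral_nonneg_AE AE_I2) (auto simp: indicator_def)

lemma half_int_pos:
  assumes f: "rapid f" "\<And>x. x \<ge> 0 \<Longrightarrow> f x \<ge> 0" and x0: "x0 \<ge> 0" "f x0 > 0"
  shows "half_int f > 0"
proof -
  have "isCont f x0" using rapid_continuous[OF f(1), of UNIV] by (simp add: continuous_on_eq_continuous_at)
  then have "\<forall>\<^sub>F x in nhds x0. f x > f x0 / 2" using x0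
    by (intro order_tendstoD(1)[where y="f x0"]) (auto simp: isCont_def tendsto_at_iff_tendsto_nhds)
  then obtain d where d: "d > 0" "\<And>x. dist x x0 < d \<Longrightarrow> f x > f x0 / 2"
    unfolding eventually_nhds_metric by blast
  define c where "c = f x0 / 2"
  let ?g = "\<lambda>x. c * indicator {x0..x0 + d / 2} x"
  have "(LINT x|lborel. ?g x) \<le> half_int f"
    unfolding half_int_def
  proof (rule integral_mono)
    show "?g x \<le> f x * indicator {0..} x" for x
      using d(2)[of x] d(1) x0 f(2)[of x] unfolding c_def by (auto simp: indicator_def dist_real_def)
    show "integrable lborel ?g" using d(1) by (intro integrable_mult_right integrable_real_indicator) auto
  qed (rule half_int_integrable[OF f(1)])
  moreover have "(LINT x|lborel. ?g x) > 0" using d x0 unfolding c_def by simp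
  ultimately show ?thesis by linarith
qed

text \<open>
All integral identities below are instances: an explicit antiderivative that decays at infinity.
\<close>

lemma half_int_FTC:
  assumes B: "rapid B" and g: "rapid g" and der: "\<And>x. x \<ge> 0 \<Longrightarrow> (B has_real_derivative g x) (at x)"
  shows "half_int g = - B 0"
proof -
  have "(\<lambda>n. LINT x|lborel. g x * indicator {0..real n} x) \<longlonglongrightarrow> half_int g"
    unfolding half_int_def
  proof (rule integral_dominated_convergence)
    have [measurable]: "g \<in> borel_measurable borel"
      using rapid_continuous[OF g] by (intro borel_measurable_continuous_onI)
    show "(\<lambda>x. g x * indicator {0..} x) \<in> borel_measurable lborel"
      "(\<lambda>x. g x * indicator {0..real n} x) \<in> borel_measurable lborel" for n by auto
    show "integrable lborel (\<lambda>x. \<bar>g x * indicator {0..} x\<bar>)" using half_int_integrable[OF g] by (rule integrable_abs)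
    show "AE x in lborel. (\<lambda>n. g x * indicator {0..real n} x) \<longlonglongrightarrow> g x * indicator {0..} x"
    proof (intro AE_I2 tendsto_eventually)
      fix x :: real
      obtain N :: nat where "x \<le> real N" using real_arch_simple by blast
      then have "g x * indicator {0..real n} x = g x * indicator {0..} x" if "n \<ge> N" for n
        using that by (auto simp: indicator_def)
      then show "\<forall>\<^sub>F n in sequentially. g x * indicator {0..real n} x = g x * indicator {0..} x"
        unfolding eventually_sequentially by blast
    qed
    show "AE x in lborel. norm (g x * indicator {0..real n} x) \<le> \<bar>g x * indicator {0..} x\<bar>" for n
      by (auto simp: indicator_def)
  qed
  moreover have "(LINT x|lborel. g x * indicator {0..real n} x) = B (real n) - B 0" for n
    by (rule integral_FTC_Icc_real)
      (use der rapid_continuous[OF g, of UNIV] in \<open>auto simp: continuous_on_eq_continuous_at\<close>)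
  ultimately have "(\<lambda>n. B (real n) - B 0) \<longlonglongrightarrow> half_int g" by simp
  moreover have "(\<lambda>n. B (real n) - B 0) \<longlonglongrightarrow> 0 - B 0"
  proof (intro tendsto_intros)
    obtain C where C: "C > 0" "\<And>x. x \<ge> 0 \<Longrightarrow> \<bar>B x\<bar> \<le> C * exp (- x)" using rapid_le_exp[OF B] by metis
    have "(\<lambda>n. exp (- real n)) \<longlonglongrightarrow> 0"
      by (intro filterlim_compose[OF exp_at_bot] filterlim_compose[OF filterlim_uminus_at_bot_at_top] filterlim_real_sequentially)
    then have "(\<lambda>n. C * exp (- real n)) \<longlonglongrightarrow> 0" by (rule tendsto_mult_right_zero)
    then show "(\<lambda>n. B (real n)) \<longlonglongrightarrow> 0"
      by (rule Lim_null_comparison[rotated]) (use C in auto)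
  qed
  ultimately show ?thesis using LIMSEQ_unique by fastforce
qed

text \<open>
The integrated Wronskian. The boundary term vanishes at infinity by decay and at \<open>0\<close> because both
solutions are even.
\<close>

lemma wronskian_identity:
  assumes D: "decaying m l" "decaying n k"
  shows "(l - k) * half_int (\<lambda>x. sol m l x * sol n k x)
    = (m - n) * half_int (\<lambda>x. (m + n + 2 * x\<^sup>2) * (sol m l x * sol n k x))"
proof -
  let ?p = "\<lambda>x. sol m l x * sol n k x"
  note R = rapid_sol_products[OF D]
  have "half_int (\<lambda>x. (m - n) * ((m + n + 2 * x\<^sup>2) * ?p x) - (l - k) * ?p x) = - (dsol m l 0 * sol n k 0 - sol m l 0 * dsol n k 0)"
  proof (rule half_int_FTC)
    fix x :: real assume "x \<ge> 0"
    have "(pot m x - pot n x - (l - k)) * ?p x = (m - n) * ((m + n + 2 * x\<^sup>2) * ?p x) - (l - k) * ?p x"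
      unfolding pot_def by (simp add: algebra_simps power2_eq_square)
    then show "((\<lambda>x. dsol m l x * sol n k x - sol m l x * dsol n k x) has_real_derivative
        (m - n) * ((m + n + 2 * x\<^sup>2) * ?p x) - (l - k) * ?p x) (at x)"
      using wronskian_has_deriv[of m l n k x] by simp
  qed (intro rapid_diff rapid_cmult rapid_quadratic_mult R)+
  moreover have "half_int (\<lambda>x. (m - n) * ((m + n + 2 * x\<^sup>2) * ?p x) - (l - k) * ?p x)
      = (m - n) * half_int (\<lambda>x. (m + n + 2 * x\<^sup>2) * ?p x) - (l - k) * half_int ?p"
    unfolding half_int_cmult[symmetric]
    by (intro half_int_diff rapid_cmult rapid_quadratic_mult R)
  ultimately show ?thesis by simp
qed

lemma half_int_sol_pos:
  assumes "decaying m l" "decaying n k"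
  shows "half_int (\<lambda>x. sol m l x * sol n k x) > 0"
  by (rule half_int_pos[OF rapid_sol_products(1), of _ _ _ _ 0])
    (use assms decaying_pos[OF assms(1)] decaying_pos[OF assms(2)] in \<open>auto intro!: less_imp_le\<close>)

text \<open>
For equal potentials the Wronskian identity says that \<open>(l - k)\<close> times a positive integral vanishes.
\<close>

lemma decaying_unique:
  assumes "decaying m l" "decaying m k" shows "l = k"
  using wronskian_identity[OF assms] half_int_sol_pos[OF assms] by simp

lemma decaying_iff: "decaying m l \<longleftrightarrow> l = ground m"
  using ground_decaying decaying_unique by blast

text \<open>
An energy above the threshold is crossing, one below it is growing, and both remain so for nearby
parameters.
\<close>

lemma ground_tendsto:
  assumes "s \<longlonglongrightarrow> m"
  shows "(\<lambda>n. ground (s n)) \<longlonglongrightarrow> ground m"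
proof (rule order_tendstoI)
  fix c assume c: "ground m < c"
  define c' where "c' = (ground m + c) / 2"
  have c': "ground m < c'" "c' < c" unfolding c'_def using c by auto
  obtain \<delta> where \<delta>: "\<delta> > 0" "\<And>m'. \<bar>m' - m\<bar> < \<delta> \<Longrightarrow> crossing m' c'"
    using crossing_open[OF crossing_above_ground[OF c'(1)]] by fastforce
  have "\<forall>\<^sub>F n in sequentially. \<bar>s n - m\<bar> < \<delta>" using tendstoD[OF assms \<delta>(1)] by (simp add: dist_real_def)
  then show "\<forall>\<^sub>F n in sequentially. ground (s n) < c"
    by eventually_elim (use \<delta>(2) ground_lower c' in force)
next
  fix c assume c: "c < ground m"
  define c' where "c' = (ground m + c) / 2"
  have c': "c' < ground m" "c < c'" unfolding c'_def using c by auto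
  have "\<not> crossing m c'" "\<not> decaying m c'" using ground_lower[of m c'] c' decaying_iff[of m c'] by auto
  then obtain \<delta> where \<delta>: "\<delta> > 0" "\<And>m'. \<bar>m' - m\<bar> < \<delta> \<Longrightarrow> \<not> crossing m' c'"
    using growing_open[of m c'] by fastforce
  have "\<forall>\<^sub>F n in sequentially. \<bar>s n - m\<bar> < \<delta>" using tendstoD[OF assms \<delta>(1)] by (simp add: dist_real_def)
  then show "\<forall>\<^sub>F n in sequentially. c < ground (s n)"
    by eventually_elim (use \<delta>(2) crossing_above_ground c' in \<open>meson linorder_not_less less_le_trans\<close>)
qed

section \<open>Ground states and the derivative of the energy\<close>

definition gstate :: "real \<Rightarrow> real \<Rightarrow> real" where
  "gstate m = sol m (ground m)"

lemma rapid_gstate: "rapid (\<lambda>x. gstate m x * gstate n x)"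
  unfolding gstate_def by (intro rapid_sol_products ground_decaying)

lemma gstate_pos: "gstate m x > 0"
  unfolding gstate_def by (rule decaying_pos[OF ground_decaying])

lemma gstate_tendsto:
  assumes "s \<longlonglongrightarrow> m" "x \<ge> 0"
  shows "(\<lambda>n. gstate (s n) x) \<longlonglongrightarrow> gstate m x"
proof (rule tendstoI)
  fix \<epsilon> :: real assume "\<epsilon> > 0"
  from sol_continuous_dependence[OF assms(2) this, of m "ground m"]
  obtain \<delta> where \<delta>: "\<delta> > 0" "\<And>m' l'. \<bar>m' - m\<bar> < \<delta> \<Longrightarrow> \<bar>l' - ground m\<bar> < \<delta> \<Longrightarrow> \<bar>sol m' l' x - sol m (ground m) x\<bar> < \<epsilon>"
    using assms(2) by (metis order_refl)
  show "\<forall>\<^sub>F n in sequentially. dist (gstate (s n) x) (gstate m x) < \<epsilon>"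
    using tendstoD[OF assms(1) \<delta>(1)] tendstoD[OF ground_tendsto[OF assms(1)] \<delta>(1)]
    by eventually_elim (use \<delta>(2) in \<open>simp add: gstate_def dist_real_def\<close>)
qed

lemma gstate_sequence_bound:
  assumes "s \<longlonglongrightarrow> m"
  obtains C where "C > 0" "\<And>n x. x \<ge> 0 \<Longrightarrow> \<bar>gstate (s n) x\<bar> \<le> C * exp (- x)"
proof -
  have "Bseq s" "Bseq (\<lambda>n. ground (s n))"
    using assms ground_tendsto[OF assms] by (blast intro: convergent_imp_Bseq convergentI)+
  then obtain A B where "\<And>n. \<bar>s n\<bar> \<le> A" "\<And>n. \<bar>ground (s n)\<bar> \<le> B" unfolding Bseq_def real_norm_def by metis
  then have "\<bar>s n\<bar> \<le> max A B" "\<bar>ground (s n)\<bar> \<le> max A B" for n by (simp_all add: le_max_iff_disj)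
  with decaying_uniform_bound[of "max A B"] ground_decaying that show thesis
    unfolding gstate_def by metis
qed

text \<open>
The two sequences of parameters serve both the difference quotient (one of them constant) and the
continuity of the derivative (both equal).
\<close>

lemma gstate_dominated_convergence:
  assumes s: "s \<longlonglongrightarrow> m" and t: "t \<longlonglongrightarrow> m" and a: "a \<longlonglongrightarrow> \<alpha>"
  shows "(\<lambda>n. half_int (\<lambda>x. (a n + b * x\<^sup>2) * (gstate (s n) x * gstate (t n) x)))
     \<longlonglongrightarrow> half_int (\<lambda>x. (\<alpha> + b * x\<^sup>2) * (gstate m x * gstate m x))"
proof -
  obtain C where C: "C > 0" "\<And>n x. x \<ge> 0 \<Longrightarrow> \<bar>gstate (s n) x\<bar> \<le> C * exp (- x)" using gstate_sequence_bound[OF s] by metis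
  obtain D where D: "D > 0" "\<And>n x. x \<ge> 0 \<Longrightarrow> \<bar>gstate (t n) x\<bar> \<le> D * exp (- x)" using gstate_sequence_bound[OF t] by metis
  have "Bseq a" using a by (blast intro: convergent_imp_Bseq convergentI)
  then obtain A where A: "\<And>n. \<bar>a n\<bar> \<le> A" unfolding Bseq_def real_norm_def by metis
  let ?g = "\<lambda>x. (A + \<bar>b\<bar> * x\<^sup>2) * ((C * exp (- x)) * (D * exp (- x)))"
  have g: "rapid ?g"
    using C D by (intro rapid_quadratic_mult rapid_product[where C=C and D=D] continuous_intros) auto
  have meas: "(\<lambda>x. f x * indicator {0..} x) \<in> borel_measurable lborel" if "rapid f" for f
    using half_int_integrable[OF that] by (rule borel_measurable_integrable)
  show ?thesis unfolding half_int_def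
  proof (rule integral_dominated_convergence[where w = "\<lambda>x. ?g x * indicator {0..} x"])
    show "AE x in lborel. (\<lambda>n. (a n + b * x\<^sup>2) * (gstate (s n) x * gstate (t n) x) * indicator {0..} x)
        \<longlonglongrightarrow> (\<alpha> + b * x\<^sup>2) * (gstate m x * gstate m x) * indicator {0..} x"
    proof (rule AE_I2)
      fix x :: real
      show "(\<lambda>n. (a n + b * x\<^sup>2) * (gstate (s n) x * gstate (t n) x) * indicator {0..} x)
        \<longlonglongrightarrow> (\<alpha> + b * x\<^sup>2) * (gstate m x * gstate m x) * indicator {0..} x"
      proof (cases "x \<ge> 0")
        case True
        then show ?thesis by (intro tendsto_intros a gstate_tendsto s t)
      qed auto
    qed
    show "AE x in lborel. norm ((a n + b * x\<^sup>2) * (gstate (s n) x * gstate (t n) x) * indicator {0..} x)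
        \<le> ?g x * indicator {0..} x" for n
    proof (rule AE_I2)
      fix x :: real
      show "norm ((a n + b * x\<^sup>2) * (gstate (s n) x * gstate (t n) x) * indicator {0..} x) \<le> ?g x * indicator {0..} x"
      proof (cases "x \<ge> 0")
        case True
        have "\<bar>a n + b * x\<^sup>2\<bar> \<le> A + \<bar>b\<bar> * x\<^sup>2" using A[of n] abs_triangle_ineq[of "a n" "b * x\<^sup>2"] by (simp add: abs_mult)
        moreover have "\<bar>gstate (s n) x\<bar> * \<bar>gstate (t n) x\<bar> \<le> (C * exp (- x)) * (D * exp (- x))"
          using C D True by (intro mult_mono) auto
        moreover have "0 \<le> A + \<bar>b\<bar> * x\<^sup>2" using A[of 0] by (intro add_nonneg_nonneg) auto
        ultimately show ?thesis using True by (simp add: abs_mult mult_mono)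
      qed auto
    qed
  qed (intro meas half_int_integrable[OF g] rapid_quadratic_mult rapid_gstate)+
qed

text \<open>
The difference quotient of the ground state energy: the mean of \<open>m + n + 2 x\<^sup>2\<close> with respect to the
product of the two ground states. It makes sense for \<open>m = n\<close> too, where it is the derivative.
\<close>

definition weighted_mean :: "real \<Rightarrow> real \<Rightarrow> real" where
  "weighted_mean m n = half_int (\<lambda>x. (m + n + 2 * x\<^sup>2) * (gstate m x * gstate n x)) / half_int (\<lambda>x. gstate m x * gstate n x)"

lemma ground_difference: "ground m - ground n = (m - n) * weighted_mean m n"
  using wronskian_identity[OF ground_decaying ground_decaying, of m n]
    half_int_sol_pos[OF ground_decaying ground_decaying, of m n]
  unfolding weighted_mean_def gstate_def by (simp add: field_simps)

lemma weighted_mean_tendsto: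
  assumes "s \<longlonglongrightarrow> m" "t \<longlonglongrightarrow> m"
  shows "(\<lambda>n. weighted_mean (s n) (t n)) \<longlonglongrightarrow> weighted_mean m m"
  unfolding weighted_mean_def
  using gstate_dominated_convergence[OF assms tendsto_add[OF assms], of 2]
    gstate_dominated_convergence[OF assms tendsto_const[of 1], of 0]
    half_int_sol_pos[OF ground_decaying ground_decaying, of m m]
  by (intro tendsto_divide) (auto simp: gstate_def)

lemma ground_has_deriv: "(ground has_real_derivative weighted_mean m m) (at m)"
  unfolding has_field_derivative_iff tendsto_at_iff_sequentially comp_def
proof (intro allI impI)
  fix X :: "nat \<Rightarrow> real" assume X: "\<forall>i. X i \<in> UNIV - {m}" "X \<longlonglongrightarrow> m"
  then have "(ground (X n) - ground m) / (X n - m) = weighted_mean (X n) m" for n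
    using ground_difference[of "X n" m] by simp
  then show "(\<lambda>n. (ground (X n) - ground m) / (X n - m)) \<longlonglongrightarrow> weighted_mean m m"
    using weighted_mean_tendsto[OF X(2) tendsto_const] by simp
qed

lemma continuous_weighted_mean: "continuous_on UNIV (\<lambda>m. weighted_mean m m)"
  by (auto simp: continuous_on_sequentially comp_def intro: weighted_mean_tendsto)

section \<open>Smooth functions\<close>

text \<open>
A set of functions that contains a derivative of each of its members consists of smooth functions.
Smoothness of a concrete function is proved by exhibiting such a set.
\<close>

definition derivative_closed :: "(real \<Rightarrow> real) set \<Rightarrow> bool" where
  "derivative_closed A \<longleftrightarrow> (\<forall>f\<in>A. \<exists>f'\<in>A. \<forall>x. (f has_real_derivative f' x) (at x))"

lemma vderiv_of_real:
  assumes "\<And>x. (f has_real_derivative f' x) (at x)"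
  shows "vderiv (\<lambda>x. complex_of_real (f x)) = (\<lambda>x. complex_of_real (f' x))"
  unfolding vderiv_def
  by (intro ext vector_derivative_at has_vector_derivative_of_real)
    (use assms in \<open>simp add: has_real_derivative_iff_has_vector_derivative\<close>)

lemma derivative_closed_smooth:
  assumes A: "derivative_closed A" and f: "f \<in> A"
  shows "(vderiv ^^ k) (\<lambda>x. complex_of_real (f x)) differentiable (at x)"
proof -
  have "\<exists>g\<in>A. (vderiv ^^ k) (\<lambda>x. complex_of_real (f x)) = (\<lambda>x. complex_of_real (g x))"
  proof (induction k)
    case 0 show ?case using f by auto
  next
    case (Suc k)
    then obtain g where g: "g \<in> A" "(vderiv ^^ k) (\<lambda>x. complex_of_real (f x)) = (\<lambda>x. complex_of_real (g x))" by blast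
    obtain g' where g': "g' \<in> A" "\<And>x. (g has_real_derivative g' x) (at x)"
      using A g unfolding derivative_closed_def by blast
    show ?case by (rule bexI[OF _ g'(1)]) (simp add: g(2) vderiv_of_real[OF g'(2)])
  qed
  then obtain g where g: "g \<in> A" "(vderiv ^^ k) (\<lambda>x. complex_of_real (f x)) = (\<lambda>x. complex_of_real (g x))" by blast
  obtain g' where g': "\<And>x. (g has_real_derivative g' x) (at x)"
    using A g unfolding derivative_closed_def by blast
  have "((\<lambda>x. complex_of_real (g x)) has_vector_derivative complex_of_real (g' x)) (at x)"
    by (rule has_vector_derivative_of_real) (use g' in \<open>simp add: has_real_derivative_iff_has_vector_derivative\<close>)
  then show ?thesis unfolding g(2) by (rule differentiableI_vector)
qed

inductive_set generated_algebra :: "(real \<Rightarrow> real) set \<Rightarrow> (real \<Rightarrow> real) set" for B where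
  gen: "f \<in> B \<Longrightarrow> f \<in> generated_algebra B"
| const: "(\<lambda>x. c) \<in> generated_algebra B"
| add: "f \<in> generated_algebra B \<Longrightarrow> g \<in> generated_algebra B \<Longrightarrow> (\<lambda>x. f x + g x) \<in> generated_algebra B"
| mult: "f \<in> generated_algebra B \<Longrightarrow> g \<in> generated_algebra B \<Longrightarrow> (\<lambda>x. f x * g x) \<in> generated_algebra B"

lemma derivative_closed_generated_algebra:
  assumes "\<And>f. f \<in> B \<Longrightarrow> \<exists>f'\<in>generated_algebra B. \<forall>x. (f has_real_derivative f' x) (at x)"
  shows "derivative_closed (generated_algebra B)"
  unfolding derivative_closed_def
proof
  fix f assume "f \<in> generated_algebra B"
  then show "\<exists>f'\<in>generated_algebra B. \<forall>x. (f has_real_derivative f' x) (at x)"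
  proof induction
    case (gen f) then show ?case by (rule assms)
  next
    case (const c)
    then show ?case by (intro bexI[OF _ generated_algebra.const[of 0]]) auto
  next
    case (add f g)
    then obtain f' g' where "f' \<in> generated_algebra B" "g' \<in> generated_algebra B"
      "\<And>x. (f has_real_derivative f' x) (at x)" "\<And>x. (g has_real_derivative g' x) (at x)" by blast
    then show ?case by (intro bexI[of _ "\<lambda>x. f' x + g' x"] generated_algebra.add) (auto intro!: derivative_intros)
  next
    case (mult f g)
    then obtain f' g' where "f' \<in> generated_algebra B" "g' \<in> generated_algebra B"
      "\<And>x. (f has_real_derivative f' x) (at x)" "\<And>x. (g has_real_derivative g' x) (at x)" by blast
    then show ?case using mult by (intro bexI[of _ "\<lambda>x. f' x * g x + g' x * f x"])
       (auto intro!: generated_algebra.add generated_algebra.mult DERIV_mult)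
  qed
qed

text \<open>
The functions \<open>exp (- 1 / x) / x ^ k\<close>, extended by zero. The family is indexed by \<open>k\<close> because
differentiation stays in its linear span.
\<close>

definition flat :: "nat \<Rightarrow> real \<Rightarrow> real" where
  "flat k x = (if x > 0 then exp (- (1 / x)) / x ^ k else 0)"

text \<open>
Both bounds come from \<open>y ^ n \<le> n! * exp y\<close> with \<open>y = 1 / x\<close>. The quadratic one yields the derivative
at \<open>0\<close>.
\<close>

lemma flat_bound:
  shows "\<bar>flat k x\<bar> \<le> fact k" "\<bar>flat k x\<bar> \<le> fact (k + 2) * x\<^sup>2"
proof -
  have pe: "(1 / x) ^ n \<le> fact n * exp (1 / x)" if "x > 0" for n
    using that by (intro power_le_fact_exp) auto
  then have pe': "(1 / x) ^ n / exp (1 / x) \<le> fact n" if "x > 0" for n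
    using that by (subst pos_divide_le_eq) auto
  show "\<bar>flat k x\<bar> \<le> fact k"
    using pe[of k] by (auto simp: flat_def exp_minus field_simps power_divide)
  show "\<bar>flat k x\<bar> \<le> fact (k + 2) * x\<^sup>2"
  proof (cases "x > 0")
    case True
    have "flat k x = ((1 / x) ^ (k + 2) / exp (1 / x)) * x\<^sup>2"
      using True by (simp add: flat_def exp_minus field_simps power_add power2_eq_square)
    also have "\<dots> \<le> fact (k + 2) * x\<^sup>2"
      using pe'[OF True, of "k + 2"] by (intro mult_right_mono) auto
    finally show ?thesis using True by (simp add: flat_def)
  qed (auto simp: flat_def)
qed

lemma flat_has_deriv: "(flat k has_real_derivative flat (k + 2) x - real k * flat (k + 1) x) (at x)"
proof -
  consider "x > 0" | "x = 0" | "x < 0" by linarith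
  then show ?thesis
  proof cases
    case 1
    let ?E = "exp (- (1 / x))"
    have "((\<lambda>x. exp (- (1 / x)) / x ^ k) has_real_derivative
        (?E * (1 / (x * x)) * x ^ k - ?E * (real k * x ^ (k - 1))) / (x ^ k * x ^ k)) (at x)"
      by (rule DERIV_divide) (use 1 in \<open>auto intro!: derivative_eq_intros\<close>)
    also have "real k * x ^ (k - 1) = real k * (x ^ k / x)" using 1 by (cases k) auto
    also have "(?E * (1 / (x * x)) * x ^ k - ?E * (real k * (x ^ k / x))) / (x ^ k * x ^ k)
        = flat (k + 2) x - real k * flat (k + 1) x"
      using 1 by (simp add: flat_def field_simps)
    finally have "((\<lambda>x. exp (- (1 / x)) / x ^ k) has_real_derivative flat (k + 2) x - real k * flat (k + 1) x) (at x)" .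
    then show ?thesis
      by (rule has_field_derivative_transform_within_open[where S = "{0<..}"]) (use 1 in \<open>auto simp: flat_def\<close>)
  next
    case 2
    have "((\<lambda>y. (flat k y - flat k 0) / (y - 0)) \<longlongrightarrow> 0) (at 0)"
    proof (rule Lim_null_comparison)
      show "\<forall>\<^sub>F y in at 0. norm ((flat k y - flat k 0) / (y - 0)) \<le> fact (k + 2) * \<bar>y\<bar>"
      proof (rule eventually_at_filter[THEN iffD2], intro always_eventually allI impI)
        fix y :: real assume "y \<noteq> 0"
        have "\<bar>flat k y\<bar> / \<bar>y\<bar> \<le> fact (k + 2) * y\<^sup>2 / \<bar>y\<bar>" by (intro divide_right_mono flat_bound) auto
        also have "y\<^sup>2 / \<bar>y\<bar> = \<bar>y\<bar>" using \<open>y \<noteq> 0\<close> by (simp add: power2_eq_square abs_if)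
        then have "fact (k + 2) * y\<^sup>2 / \<bar>y\<bar> = fact (k + 2) * \<bar>y\<bar>" by (metis times_divide_eq_right)
        finally show "norm ((flat k y - flat k 0) / (y - 0)) \<le> fact (k + 2) * \<bar>y\<bar>"
          by (simp add: flat_def abs_divide)
      qed
      have "((\<lambda>y::real. fact (k + 2) * \<bar>y\<bar>) \<longlongrightarrow> fact (k + 2) * \<bar>0\<bar>) (at 0)" by (intro tendsto_intros)
      then show "((\<lambda>y::real. fact (k + 2) * \<bar>y\<bar>) \<longlongrightarrow> 0) (at 0)" by simp
    qed
    then show ?thesis using 2 by (simp add: has_field_derivative_iff flat_def)
  next
    case 3
    have "((\<lambda>x. 0) has_real_derivative flat (k + 2) x - real k * flat (k + 1) x) (at x)"
      using 3 by (auto simp: flat_def)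
    then show ?thesis
      by (rule has_field_derivative_transform_within_open[where S = "{..<0}"]) (use 3 in \<open>auto simp: flat_def\<close>)
  qed
qed

text \<open>
A smooth function supported in \<open>[-1, 1]\<close> with value \<open>1\<close> at \<open>0\<close>. No plateau is required: the rescaled
functions \<open>bump (r x)\<close> are bounded and tend to \<open>1\<close> pointwise as \<open>r\<close> tends to \<open>0\<close>.
\<close>

definition bump :: "real \<Rightarrow> real" where "bump x = exp 1 * flat 0 (1 - x\<^sup>2)"
definition dbump :: "real \<Rightarrow> real" where "dbump x = exp 1 * (- 2 * x) * flat 2 (1 - x\<^sup>2)"
definition ddbump :: "real \<Rightarrow> real" where
  "ddbump x = exp 1 * (4 * x\<^sup>2 * (flat 4 (1 - x\<^sup>2) - 2 * flat 3 (1 - x\<^sup>2)) - 2 * flat 2 (1 - x\<^sup>2))"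

lemmas flat_deriv_chain = DERIV_chain2[OF flat_has_deriv]

lemma bump_has_deriv: "(bump has_real_derivative dbump x) (at x)"
  unfolding bump_def[abs_def] dbump_def
  by (rule derivative_eq_intros flat_deriv_chain refl)+ (simp add: numeral_2_eq_2)

lemma dbump_has_deriv: "(dbump has_real_derivative ddbump x) (at x)"
  unfolding dbump_def[abs_def] ddbump_def
  by (rule derivative_eq_intros flat_deriv_chain refl)+ (simp add: power2_eq_square algebra_simps numeral_eq_Suc)

lemma bump_0 [simp]: "bump 0 = 1"
  by (simp add: bump_def flat_def flip: exp_add)

lemma bump_outside: "\<bar>x\<bar> \<ge> 1 \<Longrightarrow> bump x = 0"
  unfolding bump_def flat_def using abs_le_square_iff[of 1 x] by simp

lemma bump_bounded: "\<exists>K>0. \<forall>x. \<bar>bump x\<bar> \<le> K \<and> \<bar>dbump x\<bar> \<le> K \<and> \<bar>ddbump x\<bar> \<le> K"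
proof -
  have prod: "\<bar>c * flat k (1 - x\<^sup>2)\<bar> \<le> b * fact k" if "\<bar>x\<bar> < 1 \<Longrightarrow> \<bar>c\<bar> \<le> b" "b \<ge> 0" for c b k x
  proof (cases "\<bar>x\<bar> < 1")
    case True then show ?thesis unfolding abs_mult using that flat_bound(1) by (intro mult_mono) auto
  next
    case False
    then have "flat k (1 - x\<^sup>2) = 0" unfolding flat_def using abs_le_square_iff[of 1 x] by simp
    then show ?thesis using that by simp
  qed
  have x2: "x\<^sup>2 \<le> 1" if "\<bar>x\<bar> < 1" for x :: real using that abs_square_less_1[of x] by simp
  let ?e = "exp 1 :: real"
  have 1: "\<bar>bump x\<bar> \<le> ?e * fact 0" for x unfolding bump_def by (rule prod) auto
  have 2: "\<bar>dbump x\<bar> \<le> (?e * 2) * fact 2" for x unfolding dbump_def by (rule prod) (auto simp: abs_mult)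
  have 3: "\<bar>ddbump x\<bar> \<le> (?e * 4) * fact 4 + (?e * 8) * fact 3 + (?e * 2) * fact 2" for x
  proof -
    have "ddbump x = (?e * 4 * x\<^sup>2) * flat 4 (1 - x\<^sup>2) - (?e * 8 * x\<^sup>2) * flat 3 (1 - x\<^sup>2) - (?e * 2) * flat 2 (1 - x\<^sup>2)"
      unfolding ddbump_def by (simp add: algebra_simps)
    moreover have "\<bar>(?e * 4 * x\<^sup>2) * flat 4 (1 - x\<^sup>2)\<bar> \<le> (?e * 4) * fact 4" by (rule prod) (auto simp: abs_mult x2)
    moreover have "\<bar>(?e * 8 * x\<^sup>2) * flat 3 (1 - x\<^sup>2)\<bar> \<le> (?e * 8) * fact 3" by (rule prod) (auto simp: abs_mult x2)
    moreover have "\<bar>(?e * 2) * flat 2 (1 - x\<^sup>2)\<bar> \<le> (?e * 2) * fact 2" by (rule prod) auto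
    ultimately show ?thesis by linarith
  qed
  define K where "K = ?e * fact 0 + (?e * 2) * fact 2 + ((?e * 4) * fact 4 + (?e * 8) * fact 3 + (?e * 2) * fact 2)"
  have "?e * fact 0 > 0" "(?e * 2) * fact 2 > 0" "(?e * 4) * fact 4 > 0" "(?e * 8) * fact 3 > 0" by auto
  then have "\<bar>bump x\<bar> \<le> K \<and> \<bar>dbump x\<bar> \<le> K \<and> \<bar>ddbump x\<bar> \<le> K" and "K > 0" for x
    using 1[of x] 2[of x] 3[of x] unfolding K_def by linarith+
  then show ?thesis by blast
qed

section \<open>The ground state is an eigenfunction\<close>

definition truncation :: "real \<Rightarrow> real \<Rightarrow> real \<Rightarrow> real \<Rightarrow> real" where
  "truncation r m l x = bump (r * x) * sol m l x"

text \<open>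
The algebra generated by the solution, its derivative, the identity and the functions
\<open>flat k (1 - (r x)\<^sup>2)\<close> is closed under differentiation: the equation expresses \<open>u''\<close> through \<open>u\<close>.
\<close>

lemma truncation_test_function:
  assumes "r > 0"
  shows "(\<lambda>x. complex_of_real (truncation r m l x)) \<in> test_functions"
proof -
  define B where "B = {sol m l, dsol m l, \<lambda>x. x} \<union> range (\<lambda>k x. flat k (1 - (r * x)\<^sup>2))"
  let ?A = "generated_algebra B"
  have mem: "sol m l \<in> ?A" "dsol m l \<in> ?A" "(\<lambda>x. x) \<in> ?A" "(\<lambda>x. flat k (1 - (r * x)\<^sup>2)) \<in> ?A" for k
    by (auto intro!: generated_algebra.gen simp: B_def)
  note alg = generated_algebra.add generated_algebra.mult generated_algebra.const mem
  have "derivative_closed ?A"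
  proof (rule derivative_closed_generated_algebra)
    fix f assume "f \<in> B"
    then consider "f = sol m l" | "f = dsol m l" | "f = (\<lambda>x. x)" | k where "f = (\<lambda>x. flat k (1 - (r * x)\<^sup>2))"
      unfolding B_def by auto
    then show "\<exists>f'\<in>?A. \<forall>x. (f has_real_derivative f' x) (at x)"
    proof cases
      case 1 then show ?thesis using sol_has_deriv mem by blast
    next
      case 2
      have "(\<lambda>x. ((m + x * x) * (m + x * x) + - l) * sol m l x) \<in> ?A" by (intro alg)
      then show ?thesis using 2 dsol_has_deriv[of m l]
        by (intro bexI) (auto simp: pot_def power2_eq_square)
    next
      case 3
      then show ?thesis by (intro bexI[OF _ generated_algebra.const[of 1]]) auto
    next
      case 4
      have "(\<lambda>x. (flat (k + 2) (1 - (r * x)\<^sup>2) + (- real k) * flat (k + 1) (1 - (r * x)\<^sup>2)) * ((- 2 * r\<^sup>2) * x)) \<in> ?A"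
        by (intro alg)
      moreover have "(f has_real_derivative (flat (k + 2) (1 - (r * x)\<^sup>2) + (- real k) * flat (k + 1) (1 - (r * x)\<^sup>2)) * ((- 2 * r\<^sup>2) * x)) (at x)" for x
        unfolding 4 by (rule DERIV_cong, rule flat_deriv_chain, (rule derivative_eq_intros refl)+)
          (simp add: power2_eq_square algebra_simps)
      ultimately show ?thesis by (intro bexI allI)
    qed
  qed
  moreover have "truncation r m l \<in> ?A"
  proof -
    have "(\<lambda>x. (exp 1 * flat 0 (1 - (r * x)\<^sup>2)) * sol m l x) \<in> ?A" by (intro alg)
    then show ?thesis by (simp add: truncation_def[abs_def] bump_def)
  qed
  ultimately have "(vderiv ^^ k) (\<lambda>x. complex_of_real (truncation r m l x)) differentiable (at x)" for k x
    by (rule derivative_closed_smooth)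
  moreover have "compact (closure {x. complex_of_real (truncation r m l x) \<noteq> 0})"
  proof -
    have "{x. complex_of_real (truncation r m l x) \<noteq> 0} \<subseteq> {- (1 / r)..1 / r}"
    proof
      fix x assume "x \<in> {x. complex_of_real (truncation r m l x) \<noteq> 0}"
      then have "\<bar>r * x\<bar> < 1" unfolding truncation_def using bump_outside[of "r * x"] by force
      then have "\<bar>x\<bar> < 1 / r" using assms by (simp add: abs_mult field_simps)
      then show "x \<in> {- (1 / r)..1 / r}" by auto
    qed
    then have "bounded {x. complex_of_real (truncation r m l x) \<noteq> 0}" by (rule bounded_subset[rotated]) simp
    then show ?thesis by (simp add: compact_closure)
  qed
  ultimately show ?thesis unfolding test_functions_def by blast
qed

lemma H_expr_truncation:
  "H_expr m (\<lambda>x. complex_of_real (truncation r m l x)) x = complex_of_real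
     (l * sol m l x + (l * (bump (r * x) - 1) * sol m l x - 2 * r * dbump (r * x) * dsol m l x - r\<^sup>2 * ddbump (r * x) * sol m l x))"
proof -
  let ?f' = "\<lambda>x. r * dbump (r * x) * sol m l x + bump (r * x) * dsol m l x"
  let ?f'' = "\<lambda>x. r\<^sup>2 * ddbump (r * x) * sol m l x + 2 * r * dbump (r * x) * dsol m l x + bump (r * x) * ((pot m x - l) * sol m l x)"
  have 1: "(truncation r m l has_real_derivative ?f' x) (at x)" for x
    unfolding truncation_def[abs_def]
    by (rule derivative_eq_intros DERIV_chain2[OF bump_has_deriv] refl)+ (simp add: algebra_simps)
  have 2: "(?f' has_real_derivative ?f'' x) (at x)" for x
    by (rule derivative_eq_intros DERIV_chain2[OF bump_has_deriv] DERIV_chain2[OF dbump_has_deriv] refl)+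
      (simp add: power2_eq_square algebra_simps)
  have "vderiv (vderiv (\<lambda>x. complex_of_real (truncation r m l x))) = (\<lambda>x. complex_of_real (?f'' x))"
    unfolding vderiv_of_real[OF 1] by (rule vderiv_of_real[OF 2])
  then show ?thesis
    unfolding H_expr_def pot_def[symmetric] truncation_def
    by (simp only: of_real_minus[symmetric] of_real_mult[symmetric] of_real_add[symmetric]) (simp add: algebra_simps)
qed

lemma integrable_exp_abs: "integrable lborel (\<lambda>x::real. exp (- \<bar>x\<bar>))"
proof -
  have 1: "integrable lborel (\<lambda>x::real. exp (- x) * indicator {0..} x)" by (rule integrable_exp_half)
  have 2: "integrable lborel (\<lambda>x::real. exp (- (0 + (-1) * x)) * indicator {0..} (0 + (-1) * x))"
    using lborel_integrable_real_affine[OF 1, of "-1" 0] by simp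
  show ?thesis
    by (rule Bochner_Integration.integrable_bound[OF Bochner_Integration.integrable_add[OF 1 2]])
      (auto simp: indicator_def intro!: AE_I2)
qed

text \<open>
Dominated convergence for the two limits in the definition of the operator graph.
\<close>

lemma L2_null_sequence:
  fixes f :: "nat \<Rightarrow> real \<Rightarrow> real"
  assumes meas: "\<And>n. f n \<in> borel_measurable borel" and le: "\<And>n x. \<bar>f n x\<bar> \<le> K * exp (- \<bar>x\<bar>)"
    and lim: "\<And>x. (\<lambda>n. f n x) \<longlonglongrightarrow> 0"
  shows "(\<lambda>n. sqrt (LINT x|lborel. (f n x)\<^sup>2)) \<longlonglongrightarrow> 0"
proof -
  have "(\<lambda>n. LINT x|lborel. (f n x)\<^sup>2) \<longlonglongrightarrow> (LINT x|(lborel :: real measure). (0::real))"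
  proof (rule integral_dominated_convergence[where w = "\<lambda>x. K\<^sup>2 * exp (- \<bar>x\<bar>)"])
    show "integrable lborel (\<lambda>x::real. K\<^sup>2 * exp (- \<bar>x\<bar>))" by (intro integrable_mult_right integrable_exp_abs)
    show "AE x in lborel. (\<lambda>n. (f n x)\<^sup>2) \<longlonglongrightarrow> 0"
      using tendsto_power[OF lim, of _ 2] by (intro AE_I2) simp
    show "AE x in lborel. norm ((f n x)\<^sup>2) \<le> K\<^sup>2 * exp (- \<bar>x\<bar>)" for n
    proof (rule AE_I2)
      fix x :: real
      have "(f n x)\<^sup>2 \<le> (K * exp (- \<bar>x\<bar>))\<^sup>2" using le[of n x] by (meson abs_le_square_iff abs_ge_self order.trans)
      also have "\<dots> = K\<^sup>2 * (exp (- \<bar>x\<bar>) * exp (- \<bar>x\<bar>))" by (simp add: power2_eq_square)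
      also have "\<dots> \<le> K\<^sup>2 * (exp (- \<bar>x\<bar>) * 1)" by (intro mult_left_mono) auto
      finally show "norm ((f n x)\<^sup>2) \<le> K\<^sup>2 * exp (- \<bar>x\<bar>)" by simp
    qed
  qed (use meas in auto)
  then show ?thesis using tendsto_real_sqrt by fastforce
qed

lemma sol_abs_bound:
  assumes "decaying m l"
  obtains C where "C > 0" "\<And>x. \<bar>sol m l x\<bar> \<le> C * exp (- \<bar>x\<bar>)" "\<And>x. \<bar>dsol m l x\<bar> \<le> C * exp (- \<bar>x\<bar>)"
proof -
  obtain C where C: "C > 0" "\<And>x. x \<ge> 0 \<Longrightarrow> \<bar>sol m l x\<bar> \<le> C * exp (- x)" "\<And>x. x \<ge> 0 \<Longrightarrow> \<bar>dsol m l x\<bar> \<le> C * exp (- x)"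
    using decaying_bound[OF assms] by metis
  have "\<bar>sol m l x\<bar> \<le> C * exp (- \<bar>x\<bar>) \<and> \<bar>dsol m l x\<bar> \<le> C * exp (- \<bar>x\<bar>)" for x
    using C(2)[of x] C(3)[of x] C(2)[of "-x"] C(3)[of "-x"] by (cases "x \<ge> 0") auto
  then show thesis using that C(1) by blast
qed

lemma L2_space_of_real:
  assumes "continuous_on UNIV f" "\<And>x. \<bar>f x\<bar> \<le> K * exp (- \<bar>x\<bar>)"
  shows "(\<lambda>x. complex_of_real (f x)) \<in> L2_space"
proof -
  have [measurable]: "f \<in> borel_measurable borel" by (rule borel_measurable_continuous_onI[OF assms(1)])
  have "integrable lborel (\<lambda>x. (f x)\<^sup>2)"
  proof (rule Bochner_Integration.integrable_bound[OF integrable_mult_right[OF integrable_exp_abs, of "K\<^sup>2"]])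
    show "AE x in lborel. norm ((f x)\<^sup>2) \<le> norm (K\<^sup>2 * exp (- \<bar>x\<bar>))"
    proof (rule AE_I2)
      fix x :: real
      have "(f x)\<^sup>2 \<le> (K * exp (- \<bar>x\<bar>))\<^sup>2" using assms(2)[of x] by (meson abs_le_square_iff abs_ge_self order.trans)
      also have "\<dots> = K\<^sup>2 * (exp (- \<bar>x\<bar>) * exp (- \<bar>x\<bar>))" by (simp add: power2_eq_square)
      also have "\<dots> \<le> K\<^sup>2 * (exp (- \<bar>x\<bar>) * 1)" by (intro mult_left_mono) auto
      finally show "norm ((f x)\<^sup>2) \<le> norm (K\<^sup>2 * exp (- \<bar>x\<bar>))" by simp
    qed
  qed auto
  then show ?thesis unfolding L2_space_def by simp
qed

text \<open>
Applied to the truncation \<open>\<chi> u\<close>, the operator gives \<open>l \<chi> u - 2 \<chi>' u' - \<chi>'' u\<close>. The derivatives of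
\<open>\<chi> x = bump (r x)\<close> carry factors \<open>r\<close> and \<open>r\<^sup>2\<close>, so the error terms tend to zero.
\<close>

lemma decaying_H_graph:
  assumes D: "decaying m l"
  shows "H_graph m (\<lambda>x. complex_of_real (sol m l x)) (\<lambda>x. complex_of_real l * complex_of_real (sol m l x))"
proof -
  obtain C where C: "C > 0" "\<And>x. \<bar>sol m l x\<bar> \<le> C * exp (- \<bar>x\<bar>)" "\<And>x. \<bar>dsol m l x\<bar> \<le> C * exp (- \<bar>x\<bar>)"
    using sol_abs_bound[OF D] by metis
  obtain K where K: "K > 0" "\<And>x. \<bar>bump x\<bar> \<le> K" "\<And>x. \<bar>dbump x\<bar> \<le> K" "\<And>x. \<bar>ddbump x\<bar> \<le> K"
    using bump_bounded by metis
  have u: "(\<lambda>x. complex_of_real (sol m l x)) \<in> L2_space"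
    using C by (intro L2_space_of_real continuous_intros) auto
  have lu: "(\<lambda>x. complex_of_real (l * sol m l x)) \<in> L2_space"
  proof (rule L2_space_of_real)
    show "\<bar>l * sol m l x\<bar> \<le> (\<bar>l\<bar> * C) * exp (- \<bar>x\<bar>)" for x
      using mult_left_mono[OF C(2)[of x], of "\<bar>l\<bar>"] by (simp add: abs_mult mult.assoc)
  qed (intro continuous_intros continuous_on_id)
  define r where "r n = inverse (real (Suc n))" for n
  have r: "r n > 0" "r n \<le> 1" "r \<longlonglongrightarrow> 0" for n unfolding r_def using LIMSEQ_inverse_real_of_nat by (auto simp: field_simps)
  have rx: "(\<lambda>n. r n * x) \<longlonglongrightarrow> 0" for x using tendsto_mult[OF r(3) tendsto_const[of x]] by simp
  have cont: "continuous_on UNIV bump" "continuous_on UNIV dbump" "continuous_on UNIV ddbump"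
  proof -
    have fc: "continuous_on UNIV (flat k)" for k
      by (rule DERIV_continuous_on, rule has_field_derivative_at_within, rule flat_has_deriv)
    have "continuous_on UNIV (\<lambda>x. flat k (1 - x\<^sup>2))" for k
      by (rule continuous_on_compose2[OF fc]) (auto intro!: continuous_intros)
    then show "continuous_on UNIV bump" "continuous_on UNIV dbump" "continuous_on UNIV ddbump"
      unfolding bump_def[abs_def] dbump_def[abs_def] ddbump_def[abs_def] by (intro continuous_intros; blast)+
  qed
  have meas [measurable]: "bump \<in> borel_measurable borel" "dbump \<in> borel_measurable borel" "ddbump \<in> borel_measurable borel"
    "sol m l \<in> borel_measurable borel" "dsol m l \<in> borel_measurable borel"
    using cont by (auto intro!: borel_measurable_continuous_onI continuous_intros)
  have b0: "(\<lambda>n. bump (r n * x) - 1) \<longlonglongrightarrow> 0" for x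
  proof -
    have "isCont bump 0" using cont(1) by (simp add: continuous_on_eq_continuous_at)
    then have "(\<lambda>n. bump (r n * x)) \<longlonglongrightarrow> bump 0" using rx isCont_tendsto_compose by blast
    from tendsto_diff[OF this tendsto_const[of 1]] show ?thesis by simp
  qed
  have small: "(\<lambda>n. q n * g (r n * x)) \<longlonglongrightarrow> 0" if "q \<longlonglongrightarrow> 0" "\<And>x. \<bar>g x\<bar> \<le> K" for q x and g :: "real \<Rightarrow> real"
  proof (rule Lim_null_comparison)
    show "\<forall>\<^sub>F n in sequentially. norm (q n * g (r n * x)) \<le> \<bar>q n\<bar> * K"
      using that(2) by (intro always_eventually allI) (auto simp: abs_mult intro!: mult_left_mono)
    show "(\<lambda>n. \<bar>q n\<bar> * K) \<longlonglongrightarrow> 0" using tendsto_mult[OF tendsto_rabs[OF that(1)] tendsto_const[of K]] by simp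
  qed
  have r2: "(\<lambda>n. (r n)\<^sup>2) \<longlonglongrightarrow> 0" using tendsto_power[OF r(3), of 2] by simp
  let ?\<phi> = "\<lambda>n x. complex_of_real (truncation (r n) m l x)"
  have "(\<lambda>n. L2_dist (?\<phi> n) (\<lambda>x. complex_of_real (sol m l x))) \<longlonglongrightarrow> 0"
  proof -
    have "L2_dist (?\<phi> n) (\<lambda>x. complex_of_real (sol m l x)) = sqrt (LINT x|lborel. ((bump (r n * x) - 1) * sol m l x)\<^sup>2)" for n
      unfolding L2_dist_def truncation_def of_real_diff[symmetric] norm_of_real power2_abs by (simp add: algebra_simps)
    moreover have "(\<lambda>n. sqrt (LINT x|lborel. ((bump (r n * x) - 1) * sol m l x)\<^sup>2)) \<longlonglongrightarrow> 0"
    proof (rule L2_null_sequence)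
      show "\<bar>(bump (r n * x) - 1) * sol m l x\<bar> \<le> (K + 1) * C * exp (- \<bar>x\<bar>)" for n x
      proof -
        have "\<bar>bump (r n * x) - 1\<bar> \<le> K + 1" using K(2)[of "r n * x"] by linarith
        then show ?thesis unfolding abs_mult mult.assoc using C K by (intro mult_mono) auto
      qed
      show "(\<lambda>n. (bump (r n * x) - 1) * sol m l x) \<longlonglongrightarrow> 0" for x
        using tendsto_mult[OF b0[of x] tendsto_const[of "sol m l x"]] by simp
    qed auto
    ultimately show ?thesis by simp
  qed
  moreover have "(\<lambda>n. L2_dist (H_expr m (?\<phi> n)) (\<lambda>x. complex_of_real (l * sol m l x))) \<longlonglongrightarrow> 0"
  proof -
    let ?f = "\<lambda>n x. l * (bump (r n * x) - 1) * sol m l x - 2 * r n * dbump (r n * x) * dsol m l x - (r n)\<^sup>2 * ddbump (r n * x) * sol m l x"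
    have "L2_dist (H_expr m (?\<phi> n)) (\<lambda>x. complex_of_real (l * sol m l x)) = sqrt (LINT x|lborel. (?f n x)\<^sup>2)" for n
      unfolding L2_dist_def H_expr_truncation of_real_diff[symmetric] norm_of_real power2_abs by simp
    moreover have "(\<lambda>n. sqrt (LINT x|lborel. (?f n x)\<^sup>2)) \<longlonglongrightarrow> 0"
    proof (rule L2_null_sequence)
      show "\<bar>?f n x\<bar> \<le> (\<bar>l\<bar> * (K + 1) * C + 2 * K * C + K * C) * exp (- \<bar>x\<bar>)" for n x
      proof -
        have e: "exp (- \<bar>x\<bar>) > 0" by simp
        have b: "\<bar>bump (r n * x) - 1\<bar> \<le> K + 1" using K(2)[of "r n * x"] by linarith
        have "\<bar>l * (bump (r n * x) - 1) * sol m l x\<bar> \<le> (\<bar>l\<bar> * (K + 1)) * (C * exp (- \<bar>x\<bar>))"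
          unfolding abs_mult using b C K by (intro mult_mono) auto
        moreover have "\<bar>2 * r n * dbump (r n * x) * dsol m l x\<bar> \<le> (2 * 1 * K) * (C * exp (- \<bar>x\<bar>))"
          unfolding abs_mult using r(1,2)[of n] C K by (intro mult_mono) auto
        moreover have "\<bar>(r n)\<^sup>2 * ddbump (r n * x) * sol m l x\<bar> \<le> (1 * K) * (C * exp (- \<bar>x\<bar>))"
          unfolding abs_mult using r(1,2)[of n] C K by (intro mult_mono) (auto simp: power_le_one less_imp_le)
        ultimately have "\<bar>?f n x\<bar> \<le> (\<bar>l\<bar> * (K + 1)) * (C * exp (- \<bar>x\<bar>)) + (2 * 1 * K) * (C * exp (- \<bar>x\<bar>)) + (1 * K) * (C * exp (- \<bar>x\<bar>))"
          by linarith
        then show ?thesis by (simp add: algebra_simps)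
      qed
      show "(\<lambda>n. ?f n x) \<longlonglongrightarrow> 0" for x
      proof -
        have "(\<lambda>n. l * (bump (r n * x) - 1) * sol m l x - 2 * (r n * dbump (r n * x)) * dsol m l x - ((r n)\<^sup>2 * ddbump (r n * x)) * sol m l x)
           \<longlonglongrightarrow> l * 0 * sol m l x - 2 * 0 * dsol m l x - 0 * sol m l x"
          by (intro tendsto_intros b0 small r(3) r2 K)
        then show ?thesis by (simp add: mult.assoc)
      qed
    qed measurable
    ultimately show ?thesis by simp
  qed
  moreover have "?\<phi> n \<in> test_functions" for n by (rule truncation_test_function[OF r(1)])
  ultimately show ?thesis unfolding H_graph_def using u lu by (auto intro!: exI[of _ ?\<phi>])
qed

section \<open>The ground state energy is the lowest eigenvalue\<close>

text \<open>
With \<open>w = u' / u\<close> one has \<open>w' + w\<^sup>2 = V - l\<close>, and therefore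
\<open>a (- a'' + (V - l) a) = (a' - w a)\<^sup>2 - (a a' - w a\<^sup>2)'\<close>. The last term integrates to zero when \<open>a\<close> has
compact support.
\<close>

lemma factorized_energy_nonneg:
  fixes a a' a'' :: "real \<Rightarrow> real"
  assumes n: "\<not> crossing m l" and "R \<ge> 0"
    and a: "\<And>x. (a has_real_derivative a' x) (at x)" "\<And>x. (a' has_real_derivative a'' x) (at x)"
    and cont: "continuous_on UNIV a''" and supp: "\<And>x. \<bar>x\<bar> \<ge> R \<Longrightarrow> a x = 0"
  shows "integrable lborel (\<lambda>x. a x * (- a'' x + (pot m x - l) * a x))"
    and "(LINT x|lborel. a x * (- a'' x + (pot m x - l) * a x)) \<ge> 0"
proof -
  let ?g = "\<lambda>x. a x * (- a'' x + (pot m x - l) * a x)"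
  let ?w = "\<lambda>x. dsol m l x / sol m l x"
  let ?B = "\<lambda>x. a x * a' x - ?w x * (a x)\<^sup>2"
  note pos = sol_pos_if_not_crossing[OF n]
  have nz: "sol m l x \<noteq> 0" for x using pos[of x] by simp
  have ac: "continuous_on UNIV a" "continuous_on UNIV a'"
    by (rule DERIV_continuous_on, rule has_field_derivative_at_within, rule a)+
  let ?B' = "\<lambda>x. (a' x - ?w x * a x)\<^sup>2 - ?g x"
  have B: "(?B has_real_derivative ?B' x) (at x)" for x
    using nz[of x] by (auto intro!: derivative_eq_intros a simp: power2_eq_square field_simps)
  have gc: "continuous_on UNIV ?g" by (intro continuous_intros ac cont continuous_on_id)
  have B'c: "continuous_on UNIV ?B'" by (intro continuous_intros ac cont continuous_on_id) (use nz in auto)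
  have isC: "isCont ?B' x" for x using B'c by (simp add: continuous_on_eq_continuous_at)
  have gx: "?g x * indicator {- R..R} x = ?g x" for x
  proof (cases "x \<in> {- R..R}")
    case False
    then have "\<bar>x\<bar> \<ge> R" by auto
    then show ?thesis using supp[of x] by simp
  qed simp
  have gint: "integrable lborel (\<lambda>x. ?g x * indicator {- R..R} x)"
    using borel_integrable_compact[of "{- R..R}" ?g] continuous_on_subset[OF gc] by (simp add: mult.commute)
  show "integrable lborel ?g" using gint unfolding gx .
  have "0 = (LINT x|lborel. ?B' x * indicator {- R..R} x) "
    using integral_FTC_Icc_real[of "- R" R ?B ?B'] B isC supp[of R] supp[of "- R"] \<open>R \<ge> 0\<close> by simp
  moreover have "(LINT x|lborel. - ?g x * indicator {- R..R} x) \<le> (LINT x|lborel. ?B' x * indicator {- R..R} x)"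
  proof (rule integral_mono)
    show "integrable lborel (\<lambda>x. - ?g x * indicator {- R..R} x)" using integrable_minus[OF gint] by simp
    have "has_bochner_integral lborel (\<lambda>x. ?B' x * indicator {- R..R} x) (?B R - ?B (- R))"
      by (rule has_bochner_integral_FTC_Icc_real) (use B isC \<open>R \<ge> 0\<close> in auto)
    then show "integrable lborel (\<lambda>x. ?B' x * indicator {- R..R} x)" by (rule integrable.intros)
  qed (auto simp: indicator_def)
  moreover have "(LINT x|lborel. - ?g x * indicator {- R..R} x) = - (LINT x|lborel. ?g x)"
    unfolding mult_minus_left gx by (rule Bochner_Integration.integral_minus)
  ultimately show "(LINT x|lborel. ?g x) \<ge> 0" by linarith
qed

lemma test_function_facts:
  assumes "\<phi> \<in> test_functions"
  shows "\<And>x. (\<phi> has_vector_derivative vderiv \<phi> x) (at x)"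
    "\<And>x. (vderiv \<phi> has_vector_derivative vderiv (vderiv \<phi>) x) (at x)"
    "continuous_on UNIV (vderiv (vderiv \<phi>))"
    "\<exists>R\<ge>0. \<forall>x. \<bar>x\<bar> \<ge> R \<longrightarrow> \<phi> x = 0 \<and> vderiv (vderiv \<phi>) x = 0"
proof -
  have d: "(vderiv ^^ k) \<phi> differentiable (at x)" for k x using assms unfolding test_functions_def by blast
  show 1: "(\<phi> has_vector_derivative vderiv \<phi> x) (at x)" for x
    using d[of 0 x] by (simp add: vderiv_def vector_derivative_works[symmetric])
  show 2: "(vderiv \<phi> has_vector_derivative vderiv (vderiv \<phi>) x) (at x)" for x
    using d[of 1 x] by (simp add: vderiv_def[of "vderiv \<phi>"] vector_derivative_works[symmetric])
  show "continuous_on UNIV (vderiv (vderiv \<phi>))"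
    using d[of 2] by (auto simp: numeral_2_eq_2 continuous_on_eq_continuous_at intro: differentiable_imp_continuous_within)
  have "bounded {x. \<phi> x \<noteq> 0}"
    using assms unfolding test_functions_def by (auto dest!: compact_imp_bounded intro: bounded_subset[OF _ closure_subset])
  then obtain R0 where R0: "\<And>x. \<phi> x \<noteq> 0 \<Longrightarrow> \<bar>x\<bar> \<le> R0" unfolding bounded_iff by auto
  define R where "R = max 0 R0 + 1"
  have op: "open {x :: real. \<bar>x\<bar> > R0}" by (intro open_Collect_less continuous_intros)
  have zero: "vderiv g x = 0" if "\<And>x. \<bar>x\<bar> > R0 \<Longrightarrow> g x = 0" "\<bar>x\<bar> > R0" for g x
  proof -
    have "((\<lambda>x. 0) has_vector_derivative 0) (at x)" by simp
    then have "(g has_vector_derivative 0) (at x)"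
      by (rule has_vector_derivative_transform_within_open[OF _ op]) (use that in auto)
    then show ?thesis unfolding vderiv_def by (rule vector_derivative_at)
  qed
  have "\<phi> x = 0 \<and> vderiv (vderiv \<phi>) x = 0" if "\<bar>x\<bar> \<ge> R" for x
  proof -
    have z0: "\<phi> x = 0" if "\<bar>x\<bar> > R0" for x using R0[of x] that by force
    have "\<bar>x\<bar> > R0" using that unfolding R_def by auto
    then show ?thesis using z0 zero[of "vderiv \<phi>" x] zero[of \<phi>] by blast
  qed
  moreover have "R \<ge> 0" unfolding R_def by simp
  ultimately show "\<exists>R\<ge>0. \<forall>x. \<bar>x\<bar> \<ge> R \<longrightarrow> \<phi> x = 0 \<and> vderiv (vderiv \<phi>) x = 0" by blast
qed

lemma L2_space_compact_support:
  assumes "continuous_on UNIV f" "\<And>x. \<bar>x\<bar> \<ge> R \<Longrightarrow> f x = 0"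
  shows "f \<in> L2_space"
proof -
  have "integrable lborel (\<lambda>x. indicator {- R..R} x *\<^sub>R (cmod (f x))\<^sup>2)"
    by (rule borel_integrable_compact) (auto intro!: continuous_intros continuous_on_subset[OF assms(1)])
  moreover have "indicator {- R..R} x *\<^sub>R (cmod (f x))\<^sup>2 = (cmod (f x))\<^sup>2" for x
  proof (cases "x \<in> {- R..R}")
    case False
    then have "\<bar>x\<bar> \<ge> R" by auto
    then show ?thesis using assms(2)[of x] by simp
  qed simp
  ultimately have "integrable lborel (\<lambda>x. (cmod (f x))\<^sup>2)" by (simp only:)
  then show ?thesis unfolding L2_space_def using borel_measurable_continuous_onI[OF assms(1)] by simp
qed

lemma test_function_L2:
  assumes "\<phi> \<in> test_functions"
  shows "\<phi> \<in> L2_space" "H_expr m \<phi> \<in> L2_space"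
proof -
  note T = test_function_facts[OF assms]
  obtain R where R: "\<And>x. \<bar>x\<bar> \<ge> R \<Longrightarrow> \<phi> x = 0" "\<And>x. \<bar>x\<bar> \<ge> R \<Longrightarrow> vderiv (vderiv \<phi>) x = 0" using T(4) by blast
  have c: "continuous_on UNIV \<phi>"
    by (intro continuous_at_imp_continuous_on ballI has_vector_derivative_continuous[OF T(1)])
  show "\<phi> \<in> L2_space" by (rule L2_space_compact_support[OF c R(1)])
  show "H_expr m \<phi> \<in> L2_space"
  proof (rule L2_space_compact_support)
    show "continuous_on UNIV (H_expr m \<phi>)" unfolding H_expr_def by (intro continuous_intros c T(3) continuous_on_id)
    show "H_expr m \<phi> x = 0" if "\<bar>x\<bar> \<ge> R" for x unfolding H_expr_def using R that by simp
  qed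
qed

text \<open>
The operator is real, so the energy of a complex function is the sum of the energies of its real
and imaginary parts.
\<close>

lemma test_function_energy:
  assumes n: "\<not> crossing m l" and \<phi>: "\<phi> \<in> test_functions"
  shows "integrable lborel (\<lambda>x. Re (cnj (\<phi> x) * H_expr m \<phi> x) - l * (cmod (\<phi> x))\<^sup>2)"
    and "(LINT x|lborel. Re (cnj (\<phi> x) * H_expr m \<phi> x) - l * (cmod (\<phi> x))\<^sup>2) \<ge> 0"
proof -
  note T = test_function_facts[OF \<phi>]
  obtain R where R: "R \<ge> 0" "\<And>x. \<bar>x\<bar> \<ge> R \<Longrightarrow> \<phi> x = 0" using T(4) by blast
  let ?q = "\<lambda>p x. p (\<phi> x) * (- p (vderiv (vderiv \<phi>) x) + (pot m x - l) * p (\<phi> x)) :: real"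
  have part: "integrable lborel (?q p) \<and> (LINT x|lborel. ?q p x) \<ge> 0" if p: "bounded_linear p" for p :: "complex \<Rightarrow> real"
  proof -
    have der: "((\<lambda>x. p (f x)) has_real_derivative p (f' x)) (at x)"
      if "\<And>x. (f has_vector_derivative f' x) (at x)" for f f' x
      using bounded_linear.has_vector_derivative[OF p that] by (simp add: has_real_derivative_iff_has_vector_derivative)
    have "continuous_on UNIV (\<lambda>x. p (vderiv (vderiv \<phi>) x))" by (rule bounded_linear.continuous_on[OF p T(3)])
    then show ?thesis
      using factorized_energy_nonneg[OF n R(1) der[OF T(1)] der[OF T(2)]] R(2) bounded_linear.linear[OF p, THEN linear_0] by simp
  qed
  have eq: "Re (cnj (\<phi> x) * H_expr m \<phi> x) - l * (cmod (\<phi> x))\<^sup>2 = ?q Re x + ?q Im x" for x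
    unfolding H_expr_def pot_def[symmetric] cmod_power2 by (simp add: algebra_simps power2_eq_square)
  note RI = part[OF bounded_linear_Re] part[OF bounded_linear_Im]
  show "integrable lborel (\<lambda>x. Re (cnj (\<phi> x) * H_expr m \<phi> x) - l * (cmod (\<phi> x))\<^sup>2)"
    unfolding eq using RI by (intro Bochner_Integration.integrable_add) auto
  show "(LINT x|lborel. Re (cnj (\<phi> x) * H_expr m \<phi> x) - l * (cmod (\<phi> x))\<^sup>2) \<ge> 0"
    unfolding eq using RI by (subst Bochner_Integration.integral_add) auto
qed

lemma L2_diff_integrable:
  assumes "u \<in> L2_space" "v \<in> L2_space"
  shows "integrable lborel (\<lambda>x. (cmod (u x - v x))\<^sup>2)"
proof -
  have [measurable]: "u \<in> borel_measurable borel" "v \<in> borel_measurable borel" using assms unfolding L2_space_def by auto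
  have i: "integrable lborel (\<lambda>x. 2 * (cmod (u x))\<^sup>2 + 2 * (cmod (v x))\<^sup>2)"
    using assms unfolding L2_space_def by auto
  show ?thesis
  proof (rule Bochner_Integration.integrable_bound[OF i])
    show "AE x in lborel. norm ((cmod (u x - v x))\<^sup>2) \<le> norm (2 * (cmod (u x))\<^sup>2 + 2 * (cmod (v x))\<^sup>2)"
    proof (rule AE_I2)
      fix x
      have "(cmod (u x - v x))\<^sup>2 \<le> (cmod (u x) + cmod (v x))\<^sup>2" by (intro power_mono norm_triangle_ineq4) auto
      also have "\<dots> \<le> 2 * (cmod (u x))\<^sup>2 + 2 * (cmod (v x))\<^sup>2"
        using sum_squares_bound[of "cmod (u x)" "cmod (v x)"] by (simp add: power2_sum)
      finally show "norm ((cmod (u x - v x))\<^sup>2) \<le> norm (2 * (cmod (u x))\<^sup>2 + 2 * (cmod (v x))\<^sup>2)" by simp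
    qed
  qed auto
qed

text \<open>
The energy density of \<open>\<phi> = v + \<alpha>\<close> with image \<open>k v + \<beta>\<close> is \<open>(k - l) \<bar>v\<bar>\<^sup>2\<close> up to cross terms. Young's
inequality moves an arbitrarily small part of these to \<open>\<bar>v\<bar>\<^sup>2\<close> and the rest to the squares of the
errors, which makes the passage to the limit in \<open>eigenvalue_lower_bound\<close> linear in squared norms.
\<close>

lemma perturbed_energy_le:
  fixes v \<alpha> \<beta> :: complex
  assumes \<epsilon>: "\<epsilon> > 0"
  shows "Re (cnj (v + \<alpha>) * (of_real k * v + \<beta>)) - l * (cmod (v + \<alpha>))\<^sup>2
    \<le> (k - l + \<epsilon>) * (cmod v)\<^sup>2
      + (1 / (2 * \<epsilon>) + (\<bar>k\<bar> + 2 * \<bar>l\<bar>)\<^sup>2 / (2 * \<epsilon>) + 1 / 2 + \<bar>l\<bar>) * ((cmod \<alpha>)\<^sup>2 + (cmod \<beta>)\<^sup>2)"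
proof -
  define c where "c = \<bar>k\<bar> + 2 * \<bar>l\<bar>"
  let ?p = "cmod v" and ?q = "cmod \<alpha>" and ?s = "cmod \<beta>"
  have re: "c * Re (cnj x * y) \<le> \<bar>c\<bar> * (cmod x * cmod y)" for x y c
  proof -
    have "c * Re (cnj x * y) \<le> \<bar>c\<bar> * \<bar>Re (cnj x * y)\<bar>" by (metis abs_ge_self abs_mult)
    also have "\<dots> \<le> \<bar>c\<bar> * (cmod x * cmod y)"
      using abs_Re_le_cmod[of "cnj x * y"] by (intro mult_left_mono) (auto simp: norm_mult)
    finally show ?thesis .
  qed
  have "Re (cnj (v + \<alpha>) * (of_real k * v + \<beta>)) - l * (cmod (v + \<alpha>))\<^sup>2
    = (k - l) * ?p\<^sup>2 + 1 * Re (cnj v * \<beta>) + k * Re (cnj \<alpha> * v) + 1 * Re (cnj \<alpha> * \<beta>) + (- 2 * l) * Re (cnj v * \<alpha>) + (- l) * ?q\<^sup>2"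
    unfolding cmod_power2 by (simp add: algebra_simps power2_eq_square)
  also have "\<dots> \<le> (k - l) * ?p\<^sup>2 + ?p * ?s + c * (?p * ?q) + ?q * ?s + \<bar>l\<bar> * ?q\<^sup>2"
  proof -
    have "- l * ?q\<^sup>2 \<le> \<bar>l\<bar> * ?q\<^sup>2" by (intro mult_right_mono) auto
    then show ?thesis
      using re[of 1 v \<beta>] re[of k \<alpha> v] re[of 1 \<alpha> \<beta>] re[of "- 2 * l" v \<alpha>]
      unfolding c_def by (simp add: abs_mult algebra_simps)
  qed
  also have "\<dots> \<le> (k - l + \<epsilon>) * ?p\<^sup>2 + (1 / (2 * \<epsilon>) + c\<^sup>2 / (2 * \<epsilon>) + 1 / 2 + \<bar>l\<bar>) * (?q\<^sup>2 + ?s\<^sup>2)"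
  proof -
    have young: "x * y \<le> \<epsilon> / 2 * x\<^sup>2 + y\<^sup>2 / (2 * \<epsilon>)" for x y :: real
    proof -
      have "0 \<le> (\<epsilon> * x - y)\<^sup>2 / (2 * \<epsilon>)" using \<epsilon> by simp
      then show ?thesis using \<epsilon> by (simp add: power2_diff field_simps power2_eq_square)
    qed
    have 1: "?p * ?s \<le> \<epsilon> / 2 * ?p\<^sup>2 + ?s\<^sup>2 / (2 * \<epsilon>)" by (rule young)
    have 2: "c * (?p * ?q) \<le> \<epsilon> / 2 * ?p\<^sup>2 + c\<^sup>2 * ?q\<^sup>2 / (2 * \<epsilon>)" using young[of ?p "c * ?q"] by (simp add: power_mult_distrib mult_ac)
    have 3: "?q * ?s \<le> 1 / 2 * (?q\<^sup>2 + ?s\<^sup>2)" using sum_squares_bound[of ?q ?s] by simp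
    have 4: "?q\<^sup>2 \<ge> 0" "?s\<^sup>2 \<ge> 0" "?q\<^sup>2 / (2 * \<epsilon>) \<ge> 0" "c\<^sup>2 * ?s\<^sup>2 / (2 * \<epsilon>) \<ge> 0" "\<bar>l\<bar> * ?s\<^sup>2 \<ge> 0" using \<epsilon> by auto
    have "(1 / (2 * \<epsilon>) + c\<^sup>2 / (2 * \<epsilon>) + 1 / 2 + \<bar>l\<bar>) * (?q\<^sup>2 + ?s\<^sup>2)
      = ?q\<^sup>2 / (2 * \<epsilon>) + ?s\<^sup>2 / (2 * \<epsilon>) + c\<^sup>2 * ?q\<^sup>2 / (2 * \<epsilon>) + c\<^sup>2 * ?s\<^sup>2 / (2 * \<epsilon>) + 1 / 2 * (?q\<^sup>2 + ?s\<^sup>2) + \<bar>l\<bar> * ?q\<^sup>2 + \<bar>l\<bar> * ?s\<^sup>2"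
      by (simp add: ring_distribs add_divide_distrib)
    moreover have "(k - l + \<epsilon>) * ?p\<^sup>2 = (k - l) * ?p\<^sup>2 + \<epsilon> / 2 * ?p\<^sup>2 + \<epsilon> / 2 * ?p\<^sup>2" by (simp add: algebra_simps)
    ultimately show ?thesis using 1 2 3 4 by linarith
  qed
  finally show ?thesis unfolding c_def .
qed

text \<open>
For approximating test functions the integrated energy minus \<open>l\<close> times the squared norm is
nonnegative. In the limit it becomes \<open>k - l\<close> times the squared norm of the eigenvector.
\<close>

lemma eigenvalue_lower_bound:
  assumes n: "\<not> crossing m l" and k: "H_eigenvalue m (complex_of_real k)"
  shows "l \<le> k"
proof -
  obtain v where G: "H_graph m v (\<lambda>x. complex_of_real k * v x)" and nz: "\<not> (AE x in lborel. v x = 0)"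
    using k unfolding H_eigenvalue_def by blast
  obtain \<phi> where v: "v \<in> L2_space" "(\<lambda>x. complex_of_real k * v x) \<in> L2_space"
    and \<phi>: "\<And>n. \<phi> n \<in> test_functions"
    and lim: "(\<lambda>n. L2_dist (\<phi> n) v) \<longlonglongrightarrow> 0" "(\<lambda>n. L2_dist (H_expr m (\<phi> n)) (\<lambda>x. complex_of_real k * v x)) \<longlonglongrightarrow> 0"
    using G unfolding H_graph_def by blast
  define N where "N = (LINT x|lborel. (cmod (v x))\<^sup>2)"
  have vi: "integrable lborel (\<lambda>x. (cmod (v x))\<^sup>2)" using v(1) unfolding L2_space_def by simp
  have "N \<noteq> 0" unfolding N_def using nz integral_nonneg_eq_0_iff_AE[OF vi] by auto
  moreover have "N \<ge> 0" unfolding N_def by simp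
  ultimately have N: "N > 0" by simp
  have "k - l + \<epsilon> \<ge> 0" if \<epsilon>: "\<epsilon> > 0" for \<epsilon>
  proof -
    define C where "C = 1 / (2 * \<epsilon>) + (\<bar>k\<bar> + 2 * \<bar>l\<bar>)\<^sup>2 / (2 * \<epsilon>) + 1 / 2 + \<bar>l\<bar>"
    let ?a = "\<lambda>n. L2_dist (\<phi> n) v" and ?b = "\<lambda>n. L2_dist (H_expr m (\<phi> n)) (\<lambda>x. complex_of_real k * v x)"
    have "0 \<le> (k - l + \<epsilon>) * N + C * ((?a n)\<^sup>2 + (?b n)\<^sup>2)" for n
    proof -
      let ?\<alpha> = "\<lambda>x. \<phi> n x - v x" and ?\<beta> = "\<lambda>x. H_expr m (\<phi> n) x - complex_of_real k * v x"
      have i: "integrable lborel (\<lambda>x. (cmod (?\<alpha> x))\<^sup>2)" "integrable lborel (\<lambda>x. (cmod (?\<beta> x))\<^sup>2)"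
        using L2_diff_integrable test_function_L2[OF \<phi>] v by auto
      have a2: "(?a n)\<^sup>2 = (LINT x|lborel. (cmod (?\<alpha> x))\<^sup>2)" "(?b n)\<^sup>2 = (LINT x|lborel. (cmod (?\<beta> x))\<^sup>2)"
        unfolding L2_dist_def by (simp_all add: integral_nonneg_AE)
      have "0 \<le> (LINT x|lborel. Re (cnj (\<phi> n x) * H_expr m (\<phi> n) x) - l * (cmod (\<phi> n x))\<^sup>2)"
        by (rule test_function_energy(2)[OF n \<phi>])
      also have "\<dots> \<le> (LINT x|lborel. (k - l + \<epsilon>) * (cmod (v x))\<^sup>2 + C * ((cmod (?\<alpha> x))\<^sup>2 + (cmod (?\<beta> x))\<^sup>2))"
      proof (rule integral_mono)
        show "integrable lborel (\<lambda>x. Re (cnj (\<phi> n x) * H_expr m (\<phi> n) x) - l * (cmod (\<phi> n x))\<^sup>2)"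
          by (rule test_function_energy(1)[OF n \<phi>])
        show "integrable lborel (\<lambda>x. (k - l + \<epsilon>) * (cmod (v x))\<^sup>2 + C * ((cmod (?\<alpha> x))\<^sup>2 + (cmod (?\<beta> x))\<^sup>2))"
          by (intro Bochner_Integration.integrable_add integrable_mult_right vi i)
        show "Re (cnj (\<phi> n x) * H_expr m (\<phi> n) x) - l * (cmod (\<phi> n x))\<^sup>2
            \<le> (k - l + \<epsilon>) * (cmod (v x))\<^sup>2 + C * ((cmod (?\<alpha> x))\<^sup>2 + (cmod (?\<beta> x))\<^sup>2)" for x
          using perturbed_energy_le[OF \<epsilon>, of "v x" "?\<alpha> x" k "?\<beta> x" l] unfolding C_def by simp
      qed
      also have "\<dots> = (k - l + \<epsilon>) * N + C * ((?a n)\<^sup>2 + (?b n)\<^sup>2)"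
        unfolding a2 N_def using vi i by simp
      finally show ?thesis .
    qed
    moreover have "(\<lambda>n. (k - l + \<epsilon>) * N + C * ((?a n)\<^sup>2 + (?b n)\<^sup>2)) \<longlonglongrightarrow> (k - l + \<epsilon>) * N + C * (0\<^sup>2 + 0\<^sup>2)"
      by (intro tendsto_intros lim)
    ultimately have "0 \<le> (k - l + \<epsilon>) * N + C * (0\<^sup>2 + 0\<^sup>2)" by (intro LIMSEQ_le_const) auto
    then show ?thesis using N by (simp add: zero_le_mult_iff)
  qed
  (* If k < l, then half of the gap is an admissible \<epsilon>. *)
  from this[of "(l - k) / 2"] show ?thesis by (cases "l \<le> k") (auto simp: field_simps)
qed

lemma ground_eigenvalue: "H_eigenvalue m (complex_of_real (ground m))"
proof -
  have "\<not> (AE x in lborel. complex_of_real (gstate m x) = 0)"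
  proof
    assume "AE x in lborel. complex_of_real (gstate m x) = 0"
    then have "AE x in (lborel :: real measure). False"
      by eventually_elim (use gstate_pos[of m] in \<open>metis less_irrefl of_real_eq_0_iff\<close>)
    then show False using AE_iff_null_sets[of UNIV "lborel :: real measure"] by (simp add: null_sets_def)
  qed
  then show ?thesis
    unfolding H_eigenvalue_def gstate_def using decaying_H_graph[OF ground_decaying[of m]] by blast
qed

lemma lambda1_eq_ground: "lambda1 m = ground m"
  unfolding lambda1_def
  by (intro Least_equality ground_eigenvalue eigenvalue_lower_bound[OF ground_not_crossing])

section \<open>Bounds and identities for the ground state energy\<close>

lemma ground_gt_square:
  assumes "m \<ge> 0" shows "ground m > m\<^sup>2"
proof (rule ccontr)
  assume "\<not> ?thesis"
  moreover have "m\<^sup>2 \<le> pot m y" for y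
    unfolding pot_def using assms by (intro power_mono) auto
  ultimately have "ground m \<le> pot m y" for y by (meson linorder_not_less order.trans)
  then show False using not_decaying_if_coeff_nonneg(2) ground_decaying by blast
qed

lemma ground_pos: "ground m > 0"
proof (rule ccontr)
  assume "\<not> ?thesis"
  then have "ground m \<le> pot m y" for y using pot_nonneg[of m y] by linarith
  then show False using not_decaying_if_coeff_nonneg(2) ground_decaying by blast
qed

text \<open>
On the unit interval to the right of the bottom \<open>a = sqrt (- m)\<close> of a well, the potential is at most
\<open>(2 a + 1)\<^sup>2\<close>.
\<close>

lemma ground_upper:
  assumes "m \<le> 0" shows "ground m \<le> pi\<^sup>2 + (2 * sqrt (- m) + 1)\<^sup>2"
proof (rule not_crossing_le[OF ground_not_crossing])
  fix x assume x: "sqrt (- m) \<le> x" "x \<le> sqrt (- m) + 1"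
  have "sqrt (- m) \<ge> 0" using assms by simp
  then have "x \<ge> 0" using x by linarith
  have "(sqrt (- m))\<^sup>2 \<le> x\<^sup>2" "x\<^sup>2 \<le> (sqrt (- m) + 1)\<^sup>2" using x assms \<open>x \<ge> 0\<close> by (intro power_mono; auto)+
  then have "0 \<le> m + x\<^sup>2" "m + x\<^sup>2 \<le> 2 * sqrt (- m) + 1" using assms by (auto simp: power2_sum)
  then show "pot m x \<le> (2 * sqrt (- m) + 1)\<^sup>2" unfolding pot_def by (intro power_mono)
qed

definition dgstate :: "real \<Rightarrow> real \<Rightarrow> real" where
  "dgstate m = dsol m (ground m)"

lemma gstate_has_deriv: "(gstate m has_real_derivative dgstate m x) (at x within A)"
  unfolding gstate_def dgstate_def by (rule sol_has_deriv)

lemma dgstate_has_deriv: "(dgstate m has_real_derivative (pot m x - ground m) * gstate m x) (at x within A)"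
  unfolding gstate_def dgstate_def by (rule dsol_has_deriv)

lemmas gstate_derivs = DERIV_chain2[OF gstate_has_deriv] DERIV_chain2[OF dgstate_has_deriv]

lemma gstate_0 [simp]: "gstate m 0 = 1" and dgstate_0 [simp]: "dgstate m 0 = 0"
  by (auto simp: gstate_def dgstate_def)

lemma rapid_gstate_products:
  "rapid (\<lambda>x. (gstate m x)\<^sup>2)" "rapid (\<lambda>x. gstate m x * dgstate m x)" "rapid (\<lambda>x. (dgstate m x)\<^sup>2)"
  unfolding gstate_def dgstate_def power2_eq_square by (intro rapid_sol_products ground_decaying)+

definition mass :: "real \<Rightarrow> real" where "mass m = half_int (\<lambda>x. (gstate m x)\<^sup>2)"
definition kinetic :: "real \<Rightarrow> real" where "kinetic m = half_int (\<lambda>x. (dgstate m x)\<^sup>2)"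
definition potential :: "real \<Rightarrow> real" where "potential m = half_int (\<lambda>x. pot m x * (gstate m x)\<^sup>2)"
definition moment :: "real \<Rightarrow> real" where "moment m = half_int (\<lambda>x. (m + x\<^sup>2) * (gstate m x)\<^sup>2)"

lemma mass_pos: "mass m > 0"
  unfolding mass_def gstate_def power2_eq_square by (intro half_int_sol_pos ground_decaying)

text \<open>
In combination with \<open>ground_has_deriv\<close> this is the Feynman-Hellmann formula.
\<close>

lemma weighted_mean_diagonal: "weighted_mean m m = 2 * moment m / mass m"
proof -
  have "half_int (\<lambda>x. (m + m + 2 * x\<^sup>2) * (gstate m x * gstate m x))
      = half_int (\<lambda>x. 2 * ((m + x\<^sup>2) * (gstate m x)\<^sup>2))"
    by (rule arg_cong[of _ _ half_int]) (simp add: fun_eq_iff power2_eq_square algebra_simps)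
  then show ?thesis unfolding weighted_mean_def moment_def mass_def half_int_cmult by (simp add: power2_eq_square)
qed

text \<open>
The antiderivative is \<open>u u'\<close>.
\<close>

lemma energy_identity: "kinetic m + potential m = ground m * mass m"
proof -
  note R = rapid_gstate_products[of m]
  have "half_int (\<lambda>x. (dgstate m x)\<^sup>2 + pot m x * (gstate m x)\<^sup>2 - ground m * (gstate m x)\<^sup>2)
      = - (gstate m 0 * dgstate m 0)"
    by (rule half_int_FTC, rule R, intro rapid_add rapid_diff rapid_pot_mult rapid_cmult R)
      (auto intro!: derivative_eq_intros gstate_derivs simp: power2_eq_square algebra_simps)
  then show ?thesis
    unfolding kinetic_def potential_def mass_def
    by (simp add: half_int_add half_int_diff half_int_cmult R rapid_add rapid_cmult rapid_pot_mult)
qed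

text \<open>
The antiderivative is \<open>x (u'\<^sup>2 - (V - l) u\<^sup>2)\<close>, and \<open>x V' = 4 x\<^sup>2 (m + x\<^sup>2) = 4 V - 4 m (m + x\<^sup>2)\<close>.
\<close>

lemma virial_identity: "kinetic m - potential m + ground m * mass m = 4 * potential m - 4 * m * moment m"
proof -
  note R = rapid_gstate_products[of m]
  note RR = rapid_add rapid_diff rapid_pot_mult rapid_cmult rapid_shift_mult R
  let ?u2 = "\<lambda>x. (gstate m x)\<^sup>2"
  have "half_int (\<lambda>x. (dgstate m x)\<^sup>2 - 5 * (pot m x * ?u2 x) + ground m * ?u2 x + (4 * m) * ((m + x\<^sup>2) * ?u2 x))
      = - (0 * ((dgstate m 0)\<^sup>2 - pot m 0 * ?u2 0 + ground m * ?u2 0))"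
    by (rule half_int_FTC, rule rapid_xmult, intro RR, intro RR, unfold pot_def)
      (auto intro!: derivative_eq_intros gstate_derivs simp: pot_def power2_eq_square algebra_simps)
  moreover have "half_int (\<lambda>x. (dgstate m x)\<^sup>2 - 5 * (pot m x * ?u2 x) + ground m * ?u2 x + (4 * m) * ((m + x\<^sup>2) * ?u2 x))
    = kinetic m - 5 * potential m + ground m * mass m + (4 * m) * moment m"
    unfolding kinetic_def potential_def mass_def moment_def half_int_cmult[symmetric]
    by (subst half_int_add half_int_diff, (intro RR)+)+ simp
  ultimately show ?thesis by simp
qed

lemma kinetic_nonneg: "kinetic m \<ge> 0" unfolding kinetic_def by (rule half_int_nonneg) auto

text \<open>
The integral of \<open>u'\<^sup>2 + ((m + x\<^sup>2 - s) u)\<^sup>2\<close> is positive, and by the energy identity it equals twice the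
difference of the two sides. It is applied with both square roots of the energy.
\<close>

lemma moment_lt:
  assumes s: "s\<^sup>2 = ground m"
  shows "s * moment m < ground m * mass m"
proof -
  note R = rapid_gstate_products[of m]
  note RR = rapid_add rapid_diff rapid_pot_mult rapid_cmult rapid_shift_mult R
  let ?u2 = "\<lambda>x. (gstate m x)\<^sup>2"
  let ?f = "\<lambda>x. (dgstate m x)\<^sup>2 + pot m x * ?u2 x - (2 * s) * ((m + x\<^sup>2) * ?u2 x) + s\<^sup>2 * ?u2 x"
  have f: "?f x = (dgstate m x)\<^sup>2 + ((m + x\<^sup>2 - s) * gstate m x)\<^sup>2" for x
    unfolding pot_def by (simp add: power2_eq_square algebra_simps)
  obtain x0 :: real where x0: "x0 \<ge> 0" "m + x0\<^sup>2 \<noteq> s"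
  proof (cases "m = s")
    case True then show thesis by (intro that[of 1]) auto
  next
    case False then show thesis by (intro that[of 0]) auto
  qed
  have "half_int ?f > 0"
  proof (rule half_int_pos[OF _ _ x0(1)])
    show "rapid ?f" by (intro RR)
    show "?f x \<ge> 0" for x unfolding f by simp
    show "?f x0 > 0" unfolding f using x0 gstate_pos[of m x0] by (intro add_nonneg_pos) auto
  qed
  moreover have "half_int ?f = kinetic m + potential m - (2 * s) * moment m + s\<^sup>2 * mass m"
    unfolding kinetic_def potential_def mass_def moment_def half_int_cmult[symmetric]
    by (subst half_int_add half_int_diff, (intro RR)+)+ simp
  ultimately show ?thesis using energy_identity[of m] s by simp
qed

text \<open>
For any function \<open>W\<close> with \<open>W 0 = 0\<close>, the derivative of \<open>u u' + W u\<^sup>2\<close> is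
\<open>(u' + W u)\<^sup>2 + (V - l - W\<^sup>2 + W') u\<^sup>2\<close>. If the second bracket were positive everywhere, this function
would increase strictly from \<open>0\<close>, contradicting its decay. Hence \<open>l\<close> is at least the infimum of
\<open>V - W\<^sup>2 + W'\<close>. The choice \<open>W x = R x (x\<^sup>2 - R\<^sup>2) / (x\<^sup>2 + R\<^sup>2)\<close> imitates a harmonic oscillator: it has
slope \<open>R\<close> at the wells \<open>x = \<plusminus> R\<close>, and \<open>W\<^sup>2 \<le> V / 4\<close>; between the wells, where \<open>W\<close> has to turn back, the
remaining three quarters of \<open>V\<close> outweigh the negative slope.
\<close>

lemma ground_lower_well:
  assumes R: "R \<ge> 1" shows "ground (- (R\<^sup>2)) \<ge> R - 2"
proof (rule ccontr)
  define m where "m = - (R\<^sup>2)"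
  define l where "l = ground m"
  assume "\<not> ?thesis"
  then have l: "l < R - 2" unfolding l_def m_def by simp
  define W where "W = (\<lambda>x. R * (x * (x\<^sup>2 - R\<^sup>2) / (x\<^sup>2 + R\<^sup>2)))"
  define W' where "W' = (\<lambda>x. R * (1 - 2 * R\<^sup>2 * (R\<^sup>2 - x\<^sup>2) / (x\<^sup>2 + R\<^sup>2)\<^sup>2))"
  have den: "x\<^sup>2 + R\<^sup>2 > 0" for x using R by (intro add_nonneg_pos) auto
  have W: "(W has_real_derivative W' x) (at x)" for x
  proof -
    have "(W has_real_derivative R * (((x\<^sup>2 - R\<^sup>2) + x * (2 * x)) * (x\<^sup>2 + R\<^sup>2) - x * (x\<^sup>2 - R\<^sup>2) * (2 * x)) / (x\<^sup>2 + R\<^sup>2)\<^sup>2) (at x)"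
      unfolding W_def using den[of x] by (auto intro!: derivative_eq_intros simp: power2_eq_square) (simp_all add: algebra_simps)
    also have "R * (((x\<^sup>2 - R\<^sup>2) + x * (2 * x)) * (x\<^sup>2 + R\<^sup>2) - x * (x\<^sup>2 - R\<^sup>2) * (2 * x)) / (x\<^sup>2 + R\<^sup>2)\<^sup>2 = W' x"
    proof -
      have "((x\<^sup>2 - R\<^sup>2) + x * (2 * x)) * (x\<^sup>2 + R\<^sup>2) - x * (x\<^sup>2 - R\<^sup>2) * (2 * x)
        = (x\<^sup>2 + R\<^sup>2)\<^sup>2 - 2 * R\<^sup>2 * (R\<^sup>2 - x\<^sup>2)" by (simp add: power2_eq_square algebra_simps)
      then show ?thesis
        unfolding W'_def using den[of x] by (simp only: times_divide_eq_right[symmetric] diff_divide_distrib) simp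
    qed
    finally show ?thesis .
  qed
  have pos: "pot m x - l - (W x)\<^sup>2 + W' x > 0" for x
  proof -
    define t where "t = R\<^sup>2 - x\<^sup>2"
    define q where "q = x\<^sup>2 + R\<^sup>2"
    have q: "q > 0" "R\<^sup>2 \<le> q" unfolding q_def using den by auto
    have "(W x)\<^sup>2 = (R * x / q)\<^sup>2 * t\<^sup>2" unfolding W_def t_def q_def by (simp add: power2_eq_square field_simps)
    also have "\<dots> \<le> (1/4) * t\<^sup>2"
    proof (intro mult_right_mono)
      have "\<bar>R * x\<bar> \<le> q / 2" using sum_squares_bound[of R x] sum_squares_bound[of R "-x"] unfolding q_def by (auto simp: abs_if)
      then have "\<bar>R * x / q\<bar> \<le> 1 / 2" using q by (simp add: abs_divide field_simps)
      then show "(R * x / q)\<^sup>2 \<le> 1/4" using abs_le_square_iff[of "R * x / q" "1/2"] by (simp add: power2_eq_square)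
    qed auto
    finally have W2: "(W x)\<^sup>2 \<le> (1/4) * t\<^sup>2" .
    have V: "pot m x = t\<^sup>2" unfolding pot_def m_def t_def by (simp add: power2_commute)
    have "W' x \<ge> R - 2 * \<bar>t\<bar>"
    proof -
      have "2 * R\<^sup>2 * t / q\<^sup>2 \<le> 2 * \<bar>t\<bar> / R"
      proof -
        have "R * R\<^sup>2 \<le> q * q" using q R self_le_power[of R 2]
          by (intro mult_mono) (auto intro: order.trans[of R "R\<^sup>2" q])
        then have "2 * \<bar>t\<bar> * (R * R\<^sup>2) \<le> 2 * \<bar>t\<bar> * (q * q)" by (intro mult_left_mono) auto
        then have "2 * R\<^sup>2 * \<bar>t\<bar> / q\<^sup>2 \<le> 2 * \<bar>t\<bar> / R" using q R by (simp add: field_simps power2_eq_square)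
        moreover have "2 * R\<^sup>2 * t / q\<^sup>2 \<le> 2 * R\<^sup>2 * \<bar>t\<bar> / q\<^sup>2" using q by (intro divide_right_mono mult_left_mono) auto
        ultimately show ?thesis by linarith
      qed
      then have "R * (2 * R\<^sup>2 * t / q\<^sup>2) \<le> R * (2 * \<bar>t\<bar> / R)" using R by (intro mult_left_mono) auto
      then show ?thesis using R unfolding W'_def t_def[symmetric] q_def[symmetric] by (simp add: right_diff_distrib)
    qed
    moreover have "(3/4) * t\<^sup>2 - 2 * \<bar>t\<bar> + 2 > 0"
    proof -
      have "(3/4) * (\<bar>t\<bar> - 4/3)\<^sup>2 = (3/4) * t\<^sup>2 - 2 * \<bar>t\<bar> + 4/3"
        by (simp add: power2_eq_square algebra_simps)
      moreover have "(3/4) * (\<bar>t\<bar> - 4/3)\<^sup>2 \<ge> 0" by simp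
      ultimately show ?thesis by linarith
    qed
    ultimately show ?thesis using V W2 l by linarith
  qed
  let ?u = "gstate m" and ?u' = "dgstate m"
  note RR = rapid_gstate_products[of m]
  have Wu: "rapid (\<lambda>x. W x * (?u x)\<^sup>2)"
  proof (rule rapid_bound[OF rapid_cmult[OF rapid_xmult[OF RR(1)], of R]])
    have "continuous_on UNIV W" by (rule DERIV_continuous_on, rule has_field_derivative_at_within, rule W)
    then show "continuous_on UNIV (\<lambda>x. W x * (?u x)\<^sup>2)" using rapid_continuous[OF RR(1)] by (intro continuous_on_mult)
    fix x :: real assume x: "x \<ge> 0"
    have "\<bar>x\<^sup>2 - R\<^sup>2\<bar> \<le> x\<^sup>2 + R\<^sup>2" by (auto simp: abs_if)
    then have "\<bar>(x\<^sup>2 - R\<^sup>2) / (x\<^sup>2 + R\<^sup>2)\<bar> \<le> 1" using den[of x] by (simp add: abs_divide)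
    then have "R * x * \<bar>(x\<^sup>2 - R\<^sup>2) / (x\<^sup>2 + R\<^sup>2)\<bar> \<le> R * x * 1" using R x by (intro mult_left_mono) auto
    then have "\<bar>W x\<bar> \<le> R * x" unfolding W_def using R x by (simp add: abs_mult mult.assoc abs_divide)
    then have "\<bar>W x\<bar> * (?u x)\<^sup>2 \<le> R * x * (?u x)\<^sup>2" by (intro mult_right_mono) auto
    then show "\<bar>W x * (?u x)\<^sup>2\<bar> \<le> \<bar>R * (x * (?u x)\<^sup>2)\<bar>" using R x by (simp add: abs_mult)
  qed
  let ?B = "\<lambda>x. ?u x * ?u' x + W x * (?u x)\<^sup>2"
  let ?g = "\<lambda>x. (?u' x + W x * ?u x)\<^sup>2 + (pot m x - l - (W x)\<^sup>2 + W' x) * (?u x)\<^sup>2"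
  have B: "(?B has_real_derivative ?g x) (at x)" for x
    by (rule derivative_eq_intros gstate_derivs W refl)+ (simp add: l_def power2_eq_square algebra_simps)
  have gpos: "?g x > 0" for x
    by (rule add_nonneg_pos[OF zero_le_power2 mult_pos_pos[OF pos zero_less_power[OF gstate_pos]]])
  have inc: "?B x < ?B y" if "x < y" for x y
    by (rule DERIV_pos_imp_increasing[OF that, where f = ?B]) (use B gpos in blast)
  have "rapid ?B" using Wu RR by auto
  from rapid_le_exp[OF this] obtain C where "C > 0 \<and> (\<forall>x\<ge>0. \<bar>?B x\<bar> \<le> C * exp (- x))" by auto
  then have C: "C > 0" "\<And>x. x \<ge> 0 \<Longrightarrow> \<bar>?B x\<bar> \<le> C * exp (- x)" by auto
  define \<beta> where "\<beta> = ?B 1"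
  have \<beta>: "\<beta> > 0" unfolding \<beta>_def using inc[of 0 1] by (simp add: W_def)
  (* Far enough out for the exponential bound C * exp (- x) to fall below \<beta>. *)
  define x where "x = 1 + C / \<beta>"
  have x: "x > 1" unfolding x_def using C(1) \<beta> by simp
  have Bx: "\<beta> < ?B x" unfolding \<beta>_def by (rule inc[OF x])
  have "C < \<beta> * x" unfolding x_def using \<beta> by (simp add: field_simps)
  also have "\<dots> \<le> ?B x * exp x"
  proof (rule mult_mono)
    show "x \<le> exp x" using exp_ge_add_one_self[of x] by linarith
  qed (use Bx \<beta> x in linarith)+
  also have "\<dots> \<le> C * exp (- x) * exp x"
  proof (rule mult_right_mono)
    show "?B x \<le> C * exp (- x)" using C(2)[of x] x by linarith
  qed simp
  also have "\<dots> = C" by (simp add: mult.assoc flip: exp_add)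
  finally show False by simp
qed

section \<open>The range of the derivative\<close>

lemma F_eq: "F = (\<lambda>m. sqrt (ground m))"
  by (simp add: fun_eq_iff F_def lambda1_eq_ground)

text \<open>
The chain rule applied to \<open>F = sqrt (ground m)\<close>.
\<close>

definition dF :: "real \<Rightarrow> real" where "dF m = weighted_mean m m / (2 * sqrt (ground m))"

lemma F_has_deriv: "(F has_real_derivative dF m) (at m)"
  unfolding F_eq dF_def using ground_pos[of m]
  by (auto intro!: derivative_eq_intros ground_has_deriv simp: field_simps)

lemma continuous_dF: "continuous_on UNIV dF"
proof -
  have "continuous_on UNIV ground" by (rule DERIV_continuous_on, rule has_field_derivative_at_within, rule ground_has_deriv)
  then show ?thesis unfolding dF_def using ground_pos
    by (intro continuous_intros continuous_weighted_mean) (auto simp: less_imp_neq[symmetric])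
qed

lemma dF_eq_moment: "dF m = moment m / (mass m * sqrt (ground m))"
  unfolding dF_def weighted_mean_diagonal by simp

lemma dF_abs_lt: "\<bar>dF m\<bar> < 1"
proof -
  let ?s = "sqrt (ground m)"
  have s: "?s > 0" "?s * ?s = ground m" using ground_pos[of m] by auto
  have "?s\<^sup>2 = ground m" "(- ?s)\<^sup>2 = ground m" using ground_pos[of m] by auto
  note lt = this[THEN moment_lt]
  have e: "ground m * mass m = ?s * (?s * mass m)" by (metis mult.assoc s(2))
  have "?s * moment m < ?s * (?s * mass m)" using lt(1) unfolding e .
  then have 1: "moment m < ?s * mass m" using s(1) by (simp only: mult_less_cancel_left_pos)
  have "?s * - moment m < ?s * (?s * mass m)" using lt(2) unfolding e by (metis mult_minus_left mult_minus_right)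
  then have 2: "- moment m < ?s * mass m" using s(1) by (simp only: mult_less_cancel_left_pos)
  have D: "mass m * ?s > 0" using s mass_pos[of m] by simp
  show ?thesis unfolding dF_eq_moment abs_divide using D 1 2 by (simp add: divide_less_eq abs_less_iff mult.commute)
qed

lemma dF_nonneg: assumes "m \<ge> 0" shows "dF m \<ge> 0"
  unfolding dF_eq_moment moment_def using assms mass_pos[of m] ground_pos[of m]
  by (intro divide_nonneg_pos half_int_nonneg) auto

text \<open>
By the virial and energy identities, \<open>4 m\<close> times the moment is six times the potential energy minus
twice the total energy, hence at most four times the total energy. Dividing by the negative number
\<open>m\<close> turns this into a lower bound.
\<close>

lemma dF_lower:
  assumes "m < 0" shows "dF m \<ge> sqrt (ground m) / m"
proof -
  let ?s = "sqrt (ground m)"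
  have s: "?s > 0" "?s * ?s = ground m" using ground_pos[of m] by auto
  have "4 * m * moment m \<le> 4 * (ground m * mass m)"
    using energy_identity[of m] virial_identity[of m] kinetic_nonneg[of m] by linarith
  moreover have e: "ground m * mass m = ?s * (?s * mass m)" by (metis mult.assoc s(2))
  ultimately have "m * moment m \<le> ?s * (?s * mass m)" by linarith
  then have "moment m \<ge> ?s * (?s * mass m) / m" using assms by (simp add: field_simps)
  then have "moment m / (mass m * ?s) \<ge> ?s * (?s * mass m) / m / (mass m * ?s)"
    using s mass_pos[of m] by (intro divide_right_mono) auto
  moreover have "?s * (?s * mass m) / m / (mass m * ?s) = ?s / m" using s(1) mass_pos[of m] by simp
  ultimately show ?thesis unfolding dF_eq_moment by simp
qed

text \<open>
The bound \<open>sqrt (ground m) / m\<close> is of order \<open>1 / sqrt (- m)\<close>, since the energy is at most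
\<open>(\<pi> + 2 sqrt (- m) + 1)\<^sup>2\<close>.
\<close>

lemma dF_tendsto_0:
  assumes "\<epsilon> > 0" shows "\<exists>K>0. \<forall>m. m < - K \<longrightarrow> dF m > - \<epsilon>"
proof -
  (* For a = sqrt (- m) > 1 one has pi + 2 * a + 1 < 7 * a, so a > 7 / \<epsilon> suffices;
     the summand 1 ensures a > 1. *)
  define K where "K = (7 / \<epsilon> + 1)\<^sup>2"
  have K0: "K > 0" unfolding K_def using assms by (intro zero_less_power add_pos_pos) auto
  have "dF m > - \<epsilon>" if m: "m < - K" for m
  proof -
    define a where "a = sqrt (- m)"
    have a2: "a\<^sup>2 = - m" using m K0 unfolding a_def by simp
    have "sqrt K < a" unfolding a_def using m by (intro real_sqrt_less_mono) auto
    then have a: "a > 7 / \<epsilon> + 1" unfolding K_def using assms by simp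
    have "7 / \<epsilon> > 0" using assms by simp
    then have a1: "a > 1" using a by linarith
    have "ground m \<le> (pi + (2 * a + 1))\<^sup>2"
    proof -
      have "ground m \<le> pi\<^sup>2 + (2 * a + 1)\<^sup>2"
        using ground_upper[of m] m K0 unfolding a_def by simp
      moreover have "(pi + (2 * a + 1))\<^sup>2 = pi\<^sup>2 + (2 * a + 1)\<^sup>2 + 2 * pi * (2 * a + 1)"
        by (simp add: power2_sum)
      moreover have "2 * pi * (2 * a + 1) \<ge> 0" using a1 by simp
      ultimately show ?thesis by linarith
    qed
    then have "sqrt (ground m) \<le> pi + (2 * a + 1)" using a1 pi_gt_zero by (intro real_le_lsqrt) auto
    also have "\<dots> < 7 * a" using a1 pi_less_4 by linarith
    also have "7 * a < \<epsilon> * a * a" using a a1 assms by (intro mult_strict_right_mono) (auto simp: field_simps)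
    finally have "sqrt (ground m) < \<epsilon> * - m" using a2 by (simp add: power2_eq_square mult.assoc)
    then have "sqrt (ground m) / m > - \<epsilon>" using m K0 by (simp add: field_simps)
    then show ?thesis using dF_lower[of m] m K0 by linarith
  qed
  then show ?thesis using K0 by blast
qed

text \<open>
Otherwise \<open>F\<close> would be nondecreasing and the energy would stay below \<open>ground 0\<close> for all negative
parameters, although it is unbounded there.
\<close>

lemma dF_negative: "\<exists>m. dF m < 0"
proof (rule ccontr)
  assume "\<not> ?thesis"
  then have nn: "dF m \<ge> 0" for m by (simp add: linorder_not_less)
  define R where "R = ground 0 + 3"
  have R: "R \<ge> 1" unfolding R_def using ground_pos[of 0] by simp
  have "F (- (R\<^sup>2)) \<le> F 0"
    by (rule DERIV_nonneg_imp_nondecreasing[where f = F]) (use nn F_has_deriv in auto)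
  then show False using ground_lower_well[OF R] unfolding F_eq R_def by simp
qed

text \<open>
If the slope were at most \<open>c < 1\<close>, then \<open>F m \<le> F 0 + c m\<close> for \<open>m \<ge> 0\<close>, which contradicts \<open>F m > m\<close> at the
point where \<open>F 0 + c m = m\<close>.
\<close>

lemma dF_close_to_1:
  assumes "c < 1" shows "\<exists>m. dF m > c"
proof (rule ccontr)
  assume "\<not> ?thesis"
  then have le: "dF m \<le> c" for m by (simp add: linorder_not_less)
  define m where "m = F 0 / (1 - c)"
  have "(1 - c) * m = F 0" unfolding m_def using assms by simp
  then have m: "F 0 = m - c * m" "m \<ge> 0"
    using assms ground_pos[of 0] by (simp add: left_diff_distrib, simp add: m_def F_eq)
  have "F m - c * m \<le> F 0 - c * 0"
  proof (rule DERIV_nonpos_imp_nonincreasing[OF m(2)])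
    fix t :: real
    have "((\<lambda>t. F t - c * t) has_real_derivative dF t - c) (at t)"
      by (auto intro!: derivative_eq_intros F_has_deriv)
    then show "\<exists>y. ((\<lambda>t. F t - c * t) has_real_derivative y) (at t) \<and> y \<le> 0" using le by force
  qed
  moreover have "F m > m" unfolding F_eq using ground_gt_square[OF m(2)] m(2) by (intro real_less_rsqrt)
  ultimately show False using m by simp
qed

lemma range_dF: "\<exists>a. -1 < a \<and> a < 0 \<and> range dF = {a..<1}"
proof -
  obtain m0 where m0: "dF m0 < 0" using dF_negative by blast
  obtain K where K: "K > 0" "\<And>m. m < - K \<Longrightarrow> dF m > dF m0" using dF_tendsto_0[of "- dF m0"] m0 by auto
  have m0K: "m0 \<in> {-K..0}" using K(2)[of m0] dF_nonneg[of m0] m0 by force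
  obtain m1 where m1: "m1 \<in> {-K..0}" "\<And>m. m \<in> {-K..0} \<Longrightarrow> dF m1 \<le> dF m"
    using continuous_attains_inf[of "{-K..0}" dF] continuous_on_subset[OF continuous_dF] m0K by blast
  have min: "dF m1 \<le> dF m" for m
  proof (cases "m \<in> {-K..0}")
    case False
    then have "dF m0 \<le> dF m" using K(2)[of m] dF_nonneg[of m] m0 by force
    then show ?thesis using m1(2)[OF m0K] by linarith
  qed (use m1 in auto)
  have "range dF = {dF m1..<1}"
  proof (intro equalityI subsetI)
    fix y assume "y \<in> range dF"
    then show "y \<in> {dF m1..<1}" using min dF_abs_lt by (auto simp: abs_less_iff)
  next
    fix y assume y: "y \<in> {dF m1..<1}"
    then obtain m2 where m2: "dF m2 > y" using dF_close_to_1[of y] by auto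
    have "connected (range dF)" using continuous_dF by (intro connected_continuous_image) auto
    then show "y \<in> range dF" using y m2 unfolding connected_iff_interval by (metis atLeastLessThan_iff less_imp_le rangeI)
  qed
  moreover have "-1 < dF m1" using dF_abs_lt[of m1] by (simp add: abs_less_iff)
  moreover have "dF m1 < 0" using min[of m0] m0 by linarith
  ultimately show ?thesis by blast
qed

theorem proposition1p3:
  shows "(\<forall>\<mu>. F differentiable (at \<mu>)) \<and>
         (\<exists>a::real. -1 < a \<and> a < 0 \<and> range (deriv F) = {a..<1})"
proof -
  have "deriv F = dF" by (intro ext DERIV_imp_deriv F_has_deriv)
  moreover have "F differentiable (at m)" for m
    using F_has_deriv real_differentiable_def by blast
  ultimately show ?thesis using range_dF by simp
qed

end
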